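(* Let $\mathcal K$ be a kernel satisfying: $\mathcal K,\mathcal K'\in L^1(\mathbb R)$, $\int_{\mathbb R}\mathcal K(x)\,dx=1$, $\mathcal K(x)=\mathcal K(-x)\ge 0$, and $\int_{\mathbb R}\mathcal K(x)|x|\,dx<\infty$. Consider the cubic nonlinearity $f_a(u)=u(1-u)(u-a)$, $a\in(0,1)$. Then the pinning region (defined in the context) in the $(a,d)$-plane, $a\in(0,1)$, $d>0$, is bounded by the curve $$ d(a)=\begin{cases}\frac13\left(1-a+a^2-\sqrt{1-2a}\right), & a\le \tfrac12,\\[2pt] \frac13\left(1-a+a^2-\sqrt{-1+2a}\right), & a\ge\tfrac12,\end{cases} $$ that is, it is the region $\{(a,d): a\in(0,1),\ 0<d<d(a)\}$. In particular, robust pinning occurs for $0<d<\frac14$, in an interval $a\in(a_-(d),a_+(d))$, with $$ a_\pm(d)=\frac12\pm\frac92\left(d-\frac14\right)^2+\mathcal O\left(\left(d-\frac14\right)^4\right)\quad\text{as } d\nearrow\tfrac14 . $$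
   Context: Consider the nonlocal equation $u_t=d(-u+\mathcal K\ast u)+f_a(u)$, $x\in\mathbb R$, where $(\mathcal K\ast u)(x)=\int_{\mathbb R}\mathcal K(x-y)u(y)\,dy$ and $d>0$ is the coupling strength. A stationary (pinned) interface at parameters $(a,d)$ is a monotone function $u:\mathbb R\to[0,1]$, possibly discontinuous, with $u(x)\to1$ as $x\to-\infty$ and $u(x)\to 0$ as $x\to+\infty$, such that $0=d(-u+\mathcal K\ast u)+f_a(u)$ for almost every $x$; i.e. it is a front of speed $c=0$ in the traveling-wave equation $-cu_\xi=d(-u+\mathcal K\ast u)+f_a(u)$, $\xi=x-ct$. The pinning region is the set of parameters $(a,d)$ at which pinning is robust, i.e. the interior of the set of $(a,d)\in(0,1)\times(0,\infty)$ for which a stationary interface exists. *)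

theory Defs
  imports "HOL-Analysis.Analysis" "HOL-Library.Landau_Symbols"
begin

text \<open>
  Weak derivative on the real line, tested against \<open>C\<^sup>1\<close> functions of compact support.
  Kernels such as \<open>x \<mapsto> exp (- \<bar>x\<bar>) / 2\<close>, which are not differentiable everywhere,
  have to be covered.
\<close>
definition weak_derivative :: "(real \<Rightarrow> real) \<Rightarrow> (real \<Rightarrow> real) \<Rightarrow> bool" where
  "weak_derivative f g \<longleftrightarrow>
     (\<forall>\<phi> \<phi>'. (\<forall>x. (\<phi> has_real_derivative \<phi>' x) (at x)) \<and> continuous_on UNIV \<phi>' \<and>
             bounded {x. \<phi> x \<noteq> 0} \<longrightarrow>
        (LINT x|lborel. f x * \<phi>' x) = - (LINT x|lborel. g x * \<phi> x))"

definition admissible_kernel :: "(real \<Rightarrow> real) \<Rightarrow> bool" where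
  "admissible_kernel K \<longleftrightarrow>
     integrable lborel K \<and>
     (\<exists>K'. weak_derivative K K' \<and> integrable lborel K') \<and>
     (LINT x|lborel. K x) = 1 \<and>
     (\<forall>x. K x = K (- x) \<and> K x \<ge> 0) \<and>
     integrable lborel (\<lambda>x. K x * \<bar>x\<bar>)"

definition convolution :: "(real \<Rightarrow> real) \<Rightarrow> (real \<Rightarrow> real) \<Rightarrow> real \<Rightarrow> real" where
  "convolution K u x = (LINT y|lborel. K (x - y) * u y)"

definition cubic :: "real \<Rightarrow> real \<Rightarrow> real" where
  "cubic a u = u * (1 - u) * (u - a)"

definition stationary_interface ::
    "(real \<Rightarrow> real) \<Rightarrow> (real \<Rightarrow> real) \<Rightarrow> real \<Rightarrow> (real \<Rightarrow> real) \<Rightarrow> bool" where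
  "stationary_interface K f d u \<longleftrightarrow>
     (mono u \<or> antimono u) \<and> (\<forall>x. u x \<in> {0..1}) \<and>
     (u \<longlongrightarrow> 1) at_bot \<and> (u \<longlongrightarrow> 0) at_top \<and>
     (AE x in lborel. 0 = d * (- u x + convolution K u x) + f (u x))"

definition pinning_region :: "(real \<Rightarrow> real) \<Rightarrow> (real \<times> real) set" where
  "pinning_region K =
     interior {(a, d) \<in> {0<..<1} \<times> {0<..}. \<exists>u. stationary_interface K (cubic a) d u}"

definition pinning_bound :: "real \<Rightarrow> real" where
  "pinning_bound a =
     (if a \<le> 1/2 then 1/3 * (1 - a + a\<^sup>2 - sqrt (1 - 2 * a))
      else 1/3 * (1 - a + a\<^sup>2 - sqrt (- 1 + 2 * a)))"

end

theory Submission
  imports Defs "HOL-Probability.Helly_Selection"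
begin

text \<open>
  Let \<open>X\<close> be the generalised inverse of a stationary interface \<open>u\<close> and \<open>G v = d * v - cubic a v\<close>. The equation
  says that \<open>d\<close> times the convolution of \<open>K\<close> with \<open>u\<close>, a continuous decreasing function, equals \<open>G (u x)\<close>. Its values at
  \<open>X t\<close>, for \<open>t\<close> in the unit interval, have mean \<open>d / 2\<close> by the symmetry of \<open>K\<close>.

  For \<open>a < 1/2\<close>, its value at \<open>X t\<close> is at most the running maximum of \<open>G\<close> on \<open>{0..t}\<close>. The running maximum
  exceeds \<open>G\<close> by at most \<open>(1 - a + a\<^sup>2 - 3 * d)\<^sup>2 / 12\<close> in mean if \<open>G\<close> is not monotone, whereas \<open>d / 2\<close> exceeds the mean of \<open>G\<close> by
  \<open>(1 - 2 * a) / 12\<close>. This is the bound on \<open>d\<close>.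

  Conversely, below the bound \<open>G\<close> can be made increasing, with mean \<open>d / 2\<close>, by replacing it with a constant between two levels
  \<open>u1 < u2\<close> at which it takes the same value. The equation for the modified \<open>G\<close> is the Euler--Lagrange equation
  of a convex function of \<open>X\<close>. It is solved by minimising finite-dimensional discretisations, in which \<open>{u1..u2}\<close> is
  a single cell, and passing to the limit by Helly's theorem. The limit \<open>X\<close> is constant on \<open>{u1<..<u2}\<close>, so \<open>u\<close> jumps
  over the levels at which \<open>G\<close> was modified and solves the original equation.
\<close>

section \<open>Convolution and generalised inverses\<close>

text \<open>The end points are left out because the generalised inverse of a front may be infinite
  at the levels 0 and 1.\<close>

definition unit_measure :: "real measure" where
  "unit_measure = restrict_space lborel {0<..<1}"

lemma space_unit_measure [simp]: "space unit_measure = {0<..<1}"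
  by (simp add: unit_measure_def space_restrict_space)

lemma prob_space_unit_measure: "prob_space unit_measure"
  by (rule prob_spaceI) (simp add: unit_measure_def space_restrict_space emeasure_restrict_space)

interpretation unit_measure: prob_space unit_measure
  by (rule prob_space_unit_measure)

lemma prob_unit_measure [simp]: "unit_measure.prob {0<..<1} = 1"
  using unit_measure.prob_space by simp

lemma borel_measurable_unit_measure:
  "f \<in> borel_measurable borel \<Longrightarrow> f \<in> borel_measurable unit_measure"
  unfolding unit_measure_def by (rule measurable_restrict_space1) simp

lemma id_measurable_unit_measure: "(\<lambda>x. x) \<in> borel_measurable unit_measure"
  by (rule borel_measurable_unit_measure) simp

lemma antimono_measurable_unit_measure:
  fixes X :: "real \<Rightarrow> real"
  assumes "antimono_on {0<..<1} X"
  shows "X \<in> borel_measurable unit_measure"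
proof -
  have "mono_on {0<..<1} (\<lambda>x. - X x)"
    using assms by (auto simp: monotone_on_def)
  then have "(\<lambda>x. - X x) \<in> borel_measurable (restrict_space borel {0<..<1})"
    by (rule borel_measurable_mono_on_fnc)
  then have "(\<lambda>x. - (- X x)) \<in> borel_measurable (restrict_space borel {0<..<1})"
    by (rule borel_measurable_uminus)
  moreover have "sets (restrict_space borel {0<..<1::real}) = sets unit_measure"
    unfolding unit_measure_def by (rule sets_restrict_space_cong) simp
  ultimately show ?thesis
    by (simp cong: measurable_cong_sets)
qed

lemma integral_unit_measure:
  fixes f :: "real \<Rightarrow> real"
  assumes "continuous_on {0..1} f"
  shows "integrable unit_measure f" "(LINT t|unit_measure. f t) = integral {0..1} f"
proof -
  have i: "set_integrable lborel {0..1} f"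
    using borel_integrable_compact[OF _ assms] by (simp add: set_integrable_def indicator_def if_distrib cong: if_cong)
  have s: "set_integrable lborel {0<..<1} f"
    by (rule set_integrable_subset[OF i]) auto
  then show "integrable unit_measure f"
    by (simp add: unit_measure_def integrable_restrict_space set_integrable_def)
  have "(LINT t|unit_measure. f t) = (LINT t:{0<..<1}|lborel. f t)"
    by (simp add: unit_measure_def integral_restrict_space set_lebesgue_integral_def)
  also have "\<dots> = integral {0<..<1} f"
    by (rule set_borel_integral_eq_integral(2)[OF s])
  also have "\<dots> = integral {0..1} f"
    by (simp add: integral_open_interval_real)
  finally show "(LINT t|unit_measure. f t) = integral {0..1} f" .
qed

lemma unit_measure_lessThan:
  assumes "0 \<le> t" "t \<le> 1"
  shows "unit_measure.prob ({..<t} \<inter> {0<..<1}) = t"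
proof -
  have "{..<t} \<inter> {0<..<1} = {0<..<t}" using assms by auto
  then show ?thesis
    using assms by (simp add: unit_measure_def measure_restrict_space subset_iff)
qed

lemma LINT_reflect: "(LINT y|lborel. f (x - y :: real)) = (LINT y|lborel. (f y :: real))"
  using lborel_integral_real_affine[of "-1" f x] by simp

section \<open>Kernels, their tails, and convolution with decreasing fronts\<close>

locale kernel =
  fixes K :: "real \<Rightarrow> real"
  assumes K_integrable: "integrable lborel K"
    and K_mass: "(LINT x|lborel. K x) = 1"
    and K_even: "K (- x) = K x"
    and K_nonneg: "0 \<le> K x"
    and K_moment: "integrable lborel (\<lambda>x. K x * \<bar>x\<bar>)"
begin

text \<open>The convolution of \<open>K\<close> with the front that drops from 1 to 0 at the origin,
  evaluated at \<open>z\<close>.\<close>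

definition tail :: "real \<Rightarrow> real" where
  "tail z = (LINT y|lborel. K y * indicator {z<..} y)"

lemma K_measurable [measurable]: "K \<in> borel_measurable borel"
  using borel_measurable_integrable[OF K_integrable] by simp

lemma K_cut_integrable: "integrable lborel (\<lambda>y. K y * indicator {z<..} y)"
  by (rule integrable_mult_indicator[of _ lborel K, simplified real_scaleR_def mult.commute[of "indicator _ _"]])
    (auto simp: K_integrable)

text \<open>By evenness the mass beyond \<open>- z\<close> is the mass below \<open>z\<close>, and
  the point \<open>z\<close> itself is a null set.\<close>

lemma tail_add: "tail z + tail (- z) = 1"
proof -
  have 1: "tail (- z) = (LINT y|lborel. K y * indicator {..<z} y)"
    unfolding tail_def
    by (subst LINT_reflect[symmetric, of _ 0])
      (auto intro!: Bochner_Integration.integral_cong simp: K_even indicator_def)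
  have i: "integrable lborel (\<lambda>y. K y * indicator {..<z} y)"
    by (rule integrable_mult_indicator[of _ lborel K, simplified real_scaleR_def mult.commute[of "indicator _ _"]])
    (auto simp: K_integrable)
  have "tail z + tail (- z) = (LINT y|lborel. K y * indicator {z<..} y + K y * indicator {..<z} y)"
    unfolding 1 unfolding tail_def
    by (rule Bochner_Integration.integral_add[symmetric, OF K_cut_integrable i])
  also have "\<dots> = (LINT y|lborel. K y)"
    by (rule integral_cong_AE)
      (use AE_lborel_singleton[of z] in \<open>auto elim!: eventually_mono simp: indicator_def\<close>)
  finally show ?thesis using K_mass by simp
qed

lemma tail_nonneg: "0 \<le> tail z"
  unfolding tail_def by (intro Bochner_Integration.integral_nonneg) (simp add: K_nonneg)

lemma tail_le_1: "tail z \<le> 1"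
  using tail_add[of z] tail_nonneg[of "- z"] by linarith

lemma tail_antimono: "x \<le> y \<Longrightarrow> tail y \<le> tail x"
  unfolding tail_def
  by (intro integral_mono K_cut_integrable) (auto simp: indicator_def K_nonneg)

lemma tail_continuous: "continuous (at z) tail"
proof (rule continuous_at_sequentiallyI)
  fix u :: "nat \<Rightarrow> real" assume u: "u \<longlonglongrightarrow> z"
  show "(\<lambda>n. tail (u n)) \<longlonglongrightarrow> tail z"
    unfolding tail_def
  proof (rule integral_dominated_convergence[where w = K])
    show "AE x in lborel. (\<lambda>i. K x * indicator {u i<..} x) \<longlonglongrightarrow> K x * indicator {z<..} x"
      using AE_lborel_singleton[of z]
    proof eventually_elim
      case (elim x)
      then consider "x < z" | "z < x" by linarith
      then have "\<forall>\<^sub>F i in sequentially. (indicator {u i<..} x :: real) = indicator {z<..} x"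
        by cases (auto simp: indicator_def dest: order_tendstoD[OF u] elim!: eventually_mono)
      then show ?case
        by (intro tendsto_mult tendsto_const tendsto_eventually)
    qed
  qed (auto simp: K_integrable K_nonneg abs_mult indicator_def)
qed

lemma continuous_on_tail: "continuous_on A tail"
  by (simp add: continuous_at_imp_continuous_on tail_continuous)

lemma tail_measurable [measurable]: "tail \<in> borel_measurable borel"
  by (intro borel_measurable_continuous_onI continuous_on_tail)

text \<open>A decreasing front \<open>u\<close> is encoded by its generalised inverse \<open>X\<close>, where \<open>X s\<close> is the place at which \<open>u\<close>
  crosses the level \<open>s\<close>; \<open>mean_tail X\<close> is then the convolution of \<open>K\<close> with \<open>u\<close>.\<close>

definition mean_tail :: "(real \<Rightarrow> real) \<Rightarrow> real \<Rightarrow> real" where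
  "mean_tail X x = (LINT s|unit_measure. tail (x - X s))"

context
  fixes X :: "real \<Rightarrow> real"
  assumes X_measurable [measurable]: "X \<in> borel_measurable unit_measure"
begin

lemma mean_tail_integrable: "integrable unit_measure (\<lambda>s. tail (x - X s))"
  by (rule unit_measure.integrable_const_bound[where B = 1])
    (auto simp: tail_nonneg tail_le_1)

lemma mean_tail_antimono: "x \<le> y \<Longrightarrow> mean_tail X y \<le> mean_tail X x"
  unfolding mean_tail_def by (intro integral_mono mean_tail_integrable) (auto intro: tail_antimono)

lemma mean_tail_bounds: "0 \<le> mean_tail X x" "mean_tail X x \<le> 1"
proof -
  show "0 \<le> mean_tail X x"
    unfolding mean_tail_def by (intro Bochner_Integration.integral_nonneg) (simp add: tail_nonneg)
  have "mean_tail X x \<le> (LINT s|unit_measure. 1)"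
    unfolding mean_tail_def by (intro integral_mono mean_tail_integrable) (auto simp: tail_le_1)
  then show "mean_tail X x \<le> 1" by (simp add: unit_measure.prob_space)
qed

lemma mean_tail_continuous: "continuous (at x) (mean_tail X)"
proof (rule continuous_at_sequentiallyI)
  fix u :: "nat \<Rightarrow> real" assume u: "u \<longlonglongrightarrow> x"
  show "(\<lambda>n. mean_tail X (u n)) \<longlonglongrightarrow> mean_tail X x"
    unfolding mean_tail_def
  proof (rule integral_dominated_convergence[where w = "\<lambda>_. 1"])
    show "AE s in unit_measure. (\<lambda>i. tail (u i - X s)) \<longlonglongrightarrow> tail (x - X s)"
      by (intro AE_I2 isCont_tendsto_compose[OF tail_continuous] tendsto_intros u)
  qed (auto simp: tail_nonneg tail_le_1)
qed

lemma mean_tail_measurable [measurable]: "mean_tail X \<in> borel_measurable borel"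
  by (intro borel_measurable_continuous_onI continuous_at_imp_continuous_on ballI mean_tail_continuous)

text \<open>Exchanging the two integrals and using \<open>tail z + tail (- z) = 1\<close> gives the equal-area condition.\<close>

lemma mean_mean_tail: "(LINT t|unit_measure. mean_tail X (X t)) = 1/2"
proof -
  interpret p: pair_prob_space unit_measure unit_measure ..
  have i: "integrable (unit_measure \<Otimes>\<^sub>M unit_measure) (\<lambda>(t, s). tail (X t - X s))"
    by (rule p.P.integrable_const_bound[where B = 1])
      (auto simp: tail_nonneg tail_le_1 split_beta)
  let ?I = "LINT t|unit_measure. mean_tail X (X t)"
  have int: "integrable unit_measure (\<lambda>t. mean_tail X (X t))"
    by (rule unit_measure.integrable_const_bound[where B = 1]) (auto simp: mean_tail_bounds)
  have "?I = (LINT s|unit_measure. LINT t|unit_measure. tail (X t - X s))"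
    unfolding mean_tail_def using p.Fubini_integral[OF i] by simp
  also have "\<dots> = (LINT s|unit_measure. 1 - mean_tail X (X s))"
  proof (rule Bochner_Integration.integral_cong[OF refl])
    fix s
    have "(LINT t|unit_measure. tail (X t - X s)) = (LINT t|unit_measure. 1 - tail (X s - X t))"
      using tail_add by (intro Bochner_Integration.integral_cong refl) (metis add_diff_cancel_right' minus_diff_eq)
    also have "\<dots> = 1 - mean_tail X (X s)"
      unfolding mean_tail_def
      by (subst Bochner_Integration.integral_diff)
         (auto simp: mean_tail_integrable unit_measure.prob_space)
    finally show "(LINT t|unit_measure. tail (X t - X s)) = 1 - mean_tail X (X s)" .
  qed
  also have "\<dots> = 1 - ?I"
    by (subst Bochner_Integration.integral_diff) (auto simp: int unit_measure.prob_space)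
  finally show ?thesis by linarith
qed

text \<open>Layer-cake formula: \<open>u y\<close> is the measure of the levels below it, and the
  two integrations are exchanged. \<open>below\<close> and \<open>above\<close> leave the value of
  \<open>u\<close> at \<open>X s\<close> open, which is harmless because one point is a null
  set.\<close>

lemma convolution_eq_mean_tail:
  assumes u [measurable]: "u \<in> borel_measurable borel" and u01: "\<And>x. u x \<in> {0..1}"
    and below: "\<And>s y. 0 < s \<Longrightarrow> s < 1 \<Longrightarrow> y < X s \<Longrightarrow> s < u y"
    and above: "\<And>s y. 0 < s \<Longrightarrow> s < 1 \<Longrightarrow> X s < y \<Longrightarrow> u y \<le> s"
  shows "convolution K u x = mean_tail X x"
proof -
  interpret p: pair_sigma_finite lborel unit_measure ..
  have Kx: "integrable lborel (\<lambda>y. K (x - y))"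
    using lborel_integrable_real_affine[OF K_integrable, of "-1" x] by simp
  let ?f = "\<lambda>y s. K (x - y) * indicator {..<u y} s :: real"
  have inner: "(LINT s|unit_measure. ?f y s) = K (x - y) * u y" for y
    using u01[of y] by (simp add: unit_measure_lessThan)
  have m: "(\<lambda>(y, s). ?f y s) \<in> borel_measurable (lborel \<Otimes>\<^sub>M unit_measure)"
  proof -
    have "(\<lambda>(y, s). K (x - y) * (if s < u y then 1 else 0 :: real)) \<in> borel_measurable (lborel \<Otimes>\<^sub>M unit_measure)"
      using id_measurable_unit_measure [measurable] by measurable
    then show ?thesis by (simp add: indicator_def of_bool_def)
  qed
  have i: "integrable (lborel \<Otimes>\<^sub>M unit_measure) (\<lambda>(y, s). ?f y s)"
  proof (rule p.Fubini_integrable[OF m])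
    have "(\<lambda>y. LINT s|unit_measure. norm (case (y, s) of (y, s) \<Rightarrow> ?f y s)) = (\<lambda>y. K (x - y) * u y)"
      using inner by (auto simp: abs_mult K_nonneg fun_eq_iff)
    moreover have "integrable lborel (\<lambda>y. K (x - y) * u y)"
      by (rule Bochner_Integration.integrable_bound[OF Kx])
        (use u01 in \<open>auto simp: abs_mult K_nonneg intro!: mult_left_le\<close>)
    ultimately show "integrable lborel (\<lambda>y. LINT s|unit_measure. norm (case (y, s) of (y, s) \<Rightarrow> ?f y s))"
      by simp
    show "AE y in lborel. integrable unit_measure (\<lambda>s. case (y, s) of (y, s) \<Rightarrow> ?f y s)"
      by (intro AE_I2 unit_measure.integrable_const_bound[where B = "K (x - _)"])
        (auto simp: K_nonneg abs_mult indicator_def intro!: borel_measurable_unit_measure)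
  qed
  have "convolution K u x = (LINT y|lborel. LINT s|unit_measure. ?f y s)"
    by (simp only: inner convolution_def)
  also have "\<dots> = (LINT s|unit_measure. LINT y|lborel. ?f y s)"
    using p.Fubini_integral[OF i] by simp
  also have "\<dots> = (LINT s|unit_measure. tail (x - X s))"
  proof (rule Bochner_Integration.integral_cong[OF refl])
    fix s assume "s \<in> space unit_measure"
    then have s: "0 < s" "s < 1" by auto
    have "(LINT y|lborel. ?f y s) = (LINT y|lborel. K (x - y) * indicator {x - X s<..} (x - y))"
    proof (rule integral_cong_AE)
      show "AE y in lborel. ?f y s = K (x - y) * indicator {x - X s<..} (x - y)"
        using AE_lborel_singleton[of "X s"]
      proof eventually_elim
        case (elim y)
        then show ?case
          using below[OF s, of y] above[OF s, of y] by (cases y "X s" rule: linorder_cases) (auto simp: indicator_def)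
      qed
      show "(\<lambda>y. ?f y s) \<in> borel_measurable lborel"
      proof -
        have "(\<lambda>y. indicator {s<..} (u y) :: real) \<in> borel_measurable lborel"
          using measurable_compose[OF u, of "indicator {s<..}"] by simp
        moreover have "(\<lambda>y. K (x - y)) \<in> borel_measurable lborel"
          using borel_measurable_integrable[OF Kx] by simp
        ultimately have "(\<lambda>y. K (x - y) * indicator {s<..} (u y)) \<in> borel_measurable lborel"
          by (rule borel_measurable_times[rotated])
        then show ?thesis by (simp add: indicator_def)
      qed
      have "(\<lambda>z. K z * indicator {x - X s<..} z) \<in> borel_measurable borel"
        using borel_measurable_integrable[OF K_cut_integrable] by simp
      then show "(\<lambda>y. K (x - y) * indicator {x - X s<..} (x - y)) \<in> borel_measurable lborel"
        by (rule measurable_compose[rotated]) simp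
    qed
    also have "\<dots> = tail (x - X s)"
      unfolding tail_def by (rule LINT_reflect[of "\<lambda>z. K z * indicator {x - X s<..} z"])
    finally show "(LINT y|lborel. ?f y s) = tail (x - X s)" .
  qed
  finally show ?thesis by (simp add: mean_tail_def)
qed

end

end

section \<open>The discrete variational problem\<close>

text \<open>Tychonoff's theorem. Configurations are sequences indexed by all of \<open>nat\<close>,
  of which \<open>energy\<close> reads only the first \<open>N\<close> entries.\<close>

lemma compact_box_fun: "compact {X :: nat \<Rightarrow> real. \<forall>i. X i \<in> {- B..B}}"
proof -
  have "compactin (product_topology (\<lambda>i::nat. euclidean :: real topology) UNIV) (PiE UNIV (\<lambda>i. {- B..B}))"
    by (simp add: compactin_PiE compactin_euclidean_iff)
  moreover have "PiE UNIV (\<lambda>i. {- B..B}) = {X :: nat \<Rightarrow> real. \<forall>i. X i \<in> {- B..B}}"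
    by auto
  ultimately show ?thesis by (simp add: euclidean_product_topology compactin_euclidean_iff)
qed

section \<open>The pair potential and its convexity\<close>

context kernel
begin

text \<open>Half the mean of \<open>sgn (z - y)\<close> when \<open>y\<close> has density
  \<open>K\<close>.\<close>

definition sgn_mean :: "real \<Rightarrow> real" where
  "sgn_mean z = 1/2 - tail z"

text \<open>The convex primitive of \<open>sgn_mean\<close> that vanishes at 0. Subtracting
  \<open>\<bar>y\<bar>\<close> keeps the integrand within \<open>K y * \<bar>z\<bar>\<close> in
  absolute value.\<close>

definition potential :: "real \<Rightarrow> real" where
  "potential z = (LINT y|lborel. K y * (\<bar>z - y\<bar> - \<bar>y\<bar>)) / 2"

definition moment :: real where
  "moment = (LINT y|lborel. K y * \<bar>y\<bar>)"

lemma sgn_mean_mono: "x \<le> y \<Longrightarrow> sgn_mean x \<le> sgn_mean y"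
  using tail_antimono by (simp add: sgn_mean_def)

lemma sgn_mean_0: "sgn_mean 0 = 0"
  using tail_add[of 0] by (simp add: sgn_mean_def)

lemma sgn_mean_continuous: "continuous (at z) sgn_mean"
  unfolding sgn_mean_def[abs_def] by (intro continuous_intros tail_continuous)

lemma abs_sgn_mean_le: "\<bar>sgn_mean z\<bar> \<le> 1/2"
  using tail_nonneg[of z] tail_le_1[of z] unfolding sgn_mean_def by linarith

lemma potential_integrable: "integrable lborel (\<lambda>y. K y * (\<bar>z - y\<bar> - \<bar>y\<bar>))"
proof (rule Bochner_Integration.integrable_bound)
  show "integrable lborel (\<lambda>y. K y * \<bar>z\<bar>)" using K_integrable by simp
  show "AE y in lborel. norm (K y * (\<bar>z - y\<bar> - \<bar>y\<bar>)) \<le> norm (K y * \<bar>z\<bar>)"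
    by (auto simp: abs_mult K_nonneg intro!: mult_left_mono)
qed measurable

text \<open>The subgradient inequality of the absolute value, averaged over \<open>K\<close>. It
  stands in for the derivative of \<open>potential\<close> in the first-order conditions.\<close>

lemma potential_subgradient: "(b - a) * sgn_mean a \<le> potential b - potential a"
proof -
  have "(LINT y|lborel. (b - a) * K y - 2 * (b - a) * (K y * indicator {a<..} y))
      \<le> (LINT y|lborel. K y * (\<bar>b - y\<bar> - \<bar>y\<bar>) - K y * (\<bar>a - y\<bar> - \<bar>y\<bar>))"
  proof (rule integral_mono)
    fix y
    have "(b - a) * (1 - 2 * indicator {a<..} y) \<le> \<bar>b - y\<bar> - \<bar>a - y\<bar>"
      by (auto simp: indicator_def)
    from mult_left_mono[OF this K_nonneg[of y]]
    show "(b - a) * K y - 2 * (b - a) * (K y * indicator {a<..} y)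
        \<le> K y * (\<bar>b - y\<bar> - \<bar>y\<bar>) - K y * (\<bar>a - y\<bar> - \<bar>y\<bar>)"
      by (simp add: algebra_simps)
  qed (intro Bochner_Integration.integrable_diff integrable_mult_right K_integrable K_cut_integrable potential_integrable)+
  moreover have "(LINT y|lborel. (b - a) * K y - 2 * (b - a) * (K y * indicator {a<..} y))
      = (b - a) - 2 * (b - a) * tail a"
    by (subst Bochner_Integration.integral_diff)
      (simp_all add: K_integrable K_cut_integrable K_mass tail_def)
  moreover have "(LINT y|lborel. K y * (\<bar>b - y\<bar> - \<bar>y\<bar>) - K y * (\<bar>a - y\<bar> - \<bar>y\<bar>))
      = 2 * (potential b - potential a)"
    by (subst Bochner_Integration.integral_diff)
      (simp_all add: potential_integrable potential_def)
  ultimately have "(b - a) - 2 * (b - a) * tail a \<le> 2 * (potential b - potential a)"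
    by (simp only:)
  then show ?thesis by (simp add: sgn_mean_def field_simps)
qed

lemma potential_0: "potential 0 = 0"
  by (simp add: potential_def)

lemma potential_even: "potential (- z) = potential z"
  unfolding potential_def
  by (subst LINT_reflect[symmetric, of _ 0])
    (auto intro!: Bochner_Integration.integral_cong simp: K_even abs_minus_commute)

text \<open>The triangle inequality, averaged over \<open>K\<close>; the finite first moment enters
  here. It makes spread-out configurations expensive.\<close>

lemma potential_coercive: "\<bar>z\<bar> / 2 - moment \<le> potential z"
proof -
  have "(LINT y|lborel. \<bar>z\<bar> * K y - 2 * (K y * \<bar>y\<bar>)) \<le> (LINT y|lborel. K y * (\<bar>z - y\<bar> - \<bar>y\<bar>))"
  proof (rule integral_mono)
    fix y
    have "\<bar>z\<bar> - 2 * \<bar>y\<bar> \<le> \<bar>z - y\<bar> - \<bar>y\<bar>" by linarith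
    from mult_left_mono[OF this K_nonneg[of y]]
    show "\<bar>z\<bar> * K y - 2 * (K y * \<bar>y\<bar>) \<le> K y * (\<bar>z - y\<bar> - \<bar>y\<bar>)"
      by (simp add: algebra_simps)
  qed (intro Bochner_Integration.integrable_diff integrable_mult_right K_integrable K_moment potential_integrable)+
  moreover have "(LINT y|lborel. \<bar>z\<bar> * K y - 2 * (K y * \<bar>y\<bar>)) = \<bar>z\<bar> - 2 * moment"
    by (subst Bochner_Integration.integral_diff)
      (simp_all add: K_integrable K_moment K_mass moment_def)
  ultimately show ?thesis by (simp add: potential_def)
qed

lemma potential_lipschitz: "\<bar>potential b - potential a\<bar> \<le> \<bar>b - a\<bar> / 2"
proof -
  have *: "- (\<bar>v - w\<bar> / 2) \<le> potential v - potential w" for v w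
  proof -
    have "\<bar>(v - w) * sgn_mean w\<bar> \<le> \<bar>v - w\<bar> * (1/2)"
      unfolding abs_mult by (intro mult_left_mono abs_sgn_mean_le) auto
    then show ?thesis using potential_subgradient[of v w] by linarith
  qed
  show ?thesis using *[of a b] *[of b a] unfolding abs_minus_commute[of a b]
    by (intro abs_leI) linarith+
qed

lemma continuous_on_potential: "continuous_on A potential"
proof -
  have "(1/2)-lipschitz_on UNIV potential"
    by (intro lipschitz_onI) (use potential_lipschitz in \<open>auto simp: dist_real_def\<close>)
  then show ?thesis
    using lipschitz_on_continuous_on continuous_on_subset by blast
qed

lemma continuous_on_potential_compose [continuous_intros]:
  "continuous_on A f \<Longrightarrow> continuous_on A (\<lambda>x. potential (f x))"
  using continuous_on_compose2[OF continuous_on_potential[of UNIV]] by auto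

end

text \<open>The equations \<open>force X i = p i\<close> below are the Euler--Lagrange equations of the convex function \<open>energy\<close>.
  The condition on the partial sums makes \<open>energy\<close> coercive on decreasing \<open>X\<close>, up to translations.\<close>

locale discrete_balance = kernel +
  fixes N :: nat and m p :: "nat \<Rightarrow> real"
  assumes N_pos: "0 < N"
    and m_pos: "i < N \<Longrightarrow> 0 < m i"
    and m_sum: "(\<Sum>i<N. m i) = 1"
    and mp_sum: "(\<Sum>i<N. m i * p i) = 0"
    and p_decreasing: "i < j \<Longrightarrow> j < N \<Longrightarrow> p j < p i"
    and deficit_pos: "0 < k \<Longrightarrow> k < N \<Longrightarrow>
      (\<Sum>i<k. m i * p i) < (\<Sum>i<k. m i) * (1 - (\<Sum>i<k. m i)) / 2"
begin

definition energy :: "(nat \<Rightarrow> real) \<Rightarrow> real" where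
  "energy X = (\<Sum>i<N. \<Sum>j<N. m i * m j * potential (X i - X j)) / 2 - (\<Sum>i<N. m i * p i * X i)"

definition force :: "(nat \<Rightarrow> real) \<Rightarrow> nat \<Rightarrow> real" where
  "force X i = (\<Sum>j<N. m j * sgn_mean (X i - X j))"

text \<open>The coefficient of the gap \<open>X (k - 1) - X k\<close> in the energy of a widely
  spread decreasing configuration, for which \<open>potential z\<close> behaves like
  \<open>\<bar>z\<bar> / 2\<close>.\<close>

definition deficit :: "nat \<Rightarrow> real" where
  "deficit k = (\<Sum>i<k. m i) * (1 - (\<Sum>i<k. m i)) / 2 - (\<Sum>i<k. m i * p i)"

definition box :: "real \<Rightarrow> (nat \<Rightarrow> real) set" where
  "box B = {X. \<forall>i. X i \<in> {- B..B}}"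

lemma box_minimizer:
  assumes "0 \<le> B"
  obtains X where "X \<in> box B" "\<And>Y. Y \<in> box B \<Longrightarrow> energy X \<le> energy Y"
proof -
  have "continuous_on (box B) (\<lambda>X. X i)" for i
    by (rule continuous_on_subset[OF continuous_on_product_coordinates]) simp
  then have "continuous_on (box B) energy"
    unfolding energy_def[abs_def] by (intro continuous_intros) auto
  moreover have "box B \<noteq> {}" using assms by (auto simp: box_def intro!: exI[of _ "\<lambda>_. 0"])
  moreover have "compact (box B)" unfolding box_def by (rule compact_box_fun)
  ultimately show ?thesis
    using continuous_attains_inf[of "box B" energy] that by blast
qed

text \<open>Each pair containing \<open>i\<close> occurs twice in the symmetric double sum, which
  cancels the factor \<open>1/2\<close> of \<open>energy\<close>; the diagonal term vanishes by
  \<open>potential_0\<close>.\<close>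

lemma energy_upd:
  assumes "i < N"
  shows "energy (X(i := x)) - energy X =
    m i * ((\<Sum>j\<in>{..<N} - {i}. m j * (potential (x - X j) - potential (X i - X j))) - p i * (x - X i))"
proof -
  let ?A = "{..<N} - {i}"
  have split: "sum f {..<N} = f i + sum f ?A" for f :: "nat \<Rightarrow> real"
    using assms by (intro sum.remove) auto
  define R where "R = (\<Sum>k\<in>?A. \<Sum>j\<in>?A. m k * m j * potential (X k - X j)) / 2 - (\<Sum>k\<in>?A. m k * p k * X k)"
  have E: "energy (X(i := y)) = R + m i * ((\<Sum>j\<in>?A. m j * potential (y - X j)) - p i * y)" for y
  proof -
    let ?Y = "X(i := y)"
    have "(\<Sum>k\<in>?A. m k * p k * ?Y k) = (\<Sum>k\<in>?A. m k * p k * X k)"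
      by (rule sum.cong) auto
    then have lin: "(\<Sum>k<N. m k * p k * ?Y k) = m i * p i * y + (\<Sum>k\<in>?A. m k * p k * X k)"
      unfolding split by simp
    have "(\<Sum>k\<in>?A. m i * m k * potential (y - ?Y k)) = (\<Sum>k\<in>?A. m i * m k * potential (y - X k))"
      by (rule sum.cong) auto
    moreover have "(\<Sum>k\<in>?A. m k * m i * potential (?Y k - y) + (\<Sum>j\<in>?A. m k * m j * potential (?Y k - ?Y j)))
      = (\<Sum>k\<in>?A. m k * m i * potential (X k - y) + (\<Sum>j\<in>?A. m k * m j * potential (X k - X j)))"
      by (intro sum.cong refl arg_cong2[where f = "(+)"]) auto
    ultimately have "(\<Sum>k<N. \<Sum>j<N. m k * m j * potential (?Y k - ?Y j)) =
      (\<Sum>j\<in>?A. m i * m j * potential (y - X j)) +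
      (\<Sum>k\<in>?A. m k * m i * potential (X k - y) + (\<Sum>j\<in>?A. m k * m j * potential (X k - X j)))"
      unfolding split by (simp only: fun_upd_same diff_self potential_0 mult_zero_right add_0)
    also have "\<dots> = 2 * (m i * (\<Sum>j\<in>?A. m j * potential (y - X j))) +
        (\<Sum>k\<in>?A. \<Sum>j\<in>?A. m k * m j * potential (X k - X j))"
    proof -
      have "(\<Sum>k\<in>?A. m k * m i * potential (X k - y)) = m i * (\<Sum>j\<in>?A. m j * potential (y - X j))"
        unfolding sum_distrib_left
      proof (rule sum.cong[OF refl])
        fix k show "m k * m i * potential (X k - y) = m i * (m k * potential (y - X k))"
          using potential_even[of "y - X k"] by simp
      qed
      then show ?thesis by (simp add: sum.distrib sum_distrib_left mult_ac)
    qed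
    finally show ?thesis
      unfolding energy_def lin R_def by (simp add: algebra_simps add_divide_distrib)
  qed
  from E[of x] E[of "X i"] show ?thesis
    by (simp add: algebra_simps sum_subtractf)
qed

lemma force_remove: "i < N \<Longrightarrow> force X i = (\<Sum>j\<in>{..<N} - {i}. m j * sgn_mean (X i - X j))"
  unfolding force_def by (subst sum.remove[of _ i]) (auto simp: sgn_mean_0)

context
  fixes B X
  assumes X_box: "X \<in> box B" and X_min: "\<And>Y. Y \<in> box B \<Longrightarrow> energy X \<le> energy Y"
begin

text \<open>Minimality along one coordinate, with the increment of \<open>potential\<close> bounded
  by the subgradient at the new point \<open>x\<close>. Letting \<open>x\<close> tend to
  \<open>X i\<close> from one side then compares the force with \<open>p i\<close>.\<close>

lemma upd_ge:
  assumes i: "i < N" and x: "x \<in> {- B..B}"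
  shows "0 \<le> (x - X i) * ((\<Sum>j\<in>{..<N} - {i}. m j * sgn_mean (x - X j)) - p i)"
proof -
  have "X(i := x) \<in> box B" using X_box x by (auto simp: box_def)
  then have "0 \<le> energy (X(i := x)) - energy X" using X_min by simp
  then have "0 \<le> (\<Sum>j\<in>{..<N} - {i}. m j * (potential (x - X j) - potential (X i - X j))) - p i * (x - X i)"
    unfolding energy_upd[OF i] using m_pos[OF i] by (simp add: zero_le_mult_iff)
  also have "(\<Sum>j\<in>{..<N} - {i}. m j * (potential (x - X j) - potential (X i - X j))) \<le>
      (\<Sum>j\<in>{..<N} - {i}. m j * ((x - X i) * sgn_mean (x - X j)))"
  proof (intro sum_mono mult_left_mono)
    fix j assume "j \<in> {..<N} - {i}"
    then show "0 \<le> m j" using m_pos[of j] by auto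
    show "potential (x - X j) - potential (X i - X j) \<le> (x - X i) * sgn_mean (x - X j)"
      using potential_subgradient[of "X i - X j" "x - X j"] by (simp add: algebra_simps)
  qed
  finally show ?thesis by (simp add: sum_distrib_left algebra_simps)
qed

lemma force_tendsto:
  assumes "i < N"
  shows "((\<lambda>x. \<Sum>j\<in>{..<N} - {i}. m j * sgn_mean (x - X j)) \<longlongrightarrow> force X i) (at (X i) within S)"
  unfolding force_remove[OF assms]
  by (intro tendsto_intros isCont_tendsto_compose[OF sgn_mean_continuous])

text \<open>Off the upper wall of the box \<open>X i\<close> can be increased, which gives one
  inequality; off the lower wall \<open>force_le\<close> gives the other. Equality needs a point off
  both walls.\<close>

lemma force_ge:
  assumes i: "i < N" and "X i < B"
  shows "p i \<le> force X i"
proof (rule tendsto_lowerbound[OF force_tendsto[OF i, of "{X i<..}"]])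
  show "\<forall>\<^sub>F x in at_right (X i). p i \<le> (\<Sum>j\<in>{..<N} - {i}. m j * sgn_mean (x - X j))"
    unfolding eventually_at_right[OF \<open>X i < B\<close>]
  proof (intro exI[of _ B] conjI allI impI assms)
    fix x assume x: "X i < x" "x < B"
    moreover have "- B \<le> X i" using X_box by (auto simp: box_def)
    ultimately show "p i \<le> (\<Sum>j\<in>{..<N} - {i}. m j * sgn_mean (x - X j))"
      using upd_ge[OF i, of x] by (auto simp: zero_le_mult_iff)
  qed
qed simp

lemma force_le:
  assumes i: "i < N" and "- B < X i"
  shows "force X i \<le> p i"
proof (rule tendsto_upperbound[OF force_tendsto[OF i, of "{..<X i}"]])
  show "\<forall>\<^sub>F x in at_left (X i). (\<Sum>j\<in>{..<N} - {i}. m j * sgn_mean (x - X j)) \<le> p i"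
    unfolding eventually_at_left[OF \<open>- B < X i\<close>]
  proof (intro exI[of _ "- B"] conjI allI impI assms)
    fix x assume x: "- B < x" "x < X i"
    moreover have "X i \<le> B" using X_box by (auto simp: box_def)
    ultimately show "(\<Sum>j\<in>{..<N} - {i}. m j * sgn_mean (x - X j)) \<le> p i"
      using upd_ge[OF i, of x] by (auto simp: zero_le_mult_iff)
  qed
qed simp

text \<open>Two coordinates in the wrong order are off the walls that matter for
  \<open>force_ge\<close> and \<open>force_le\<close>. Since \<open>sgn_mean\<close> is increasing,
  their forces are ordered against the strict decrease of \<open>p\<close>. The order is thus a
  consequence of minimality and not a constraint.\<close>

lemma minimizer_antimono:
  assumes "i \<le> j" "j < N"
  shows "X j \<le> X i"
proof (rule ccontr)
  assume neg: "\<not> X j \<le> X i"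
  then have ij: "i < j" using assms(1) by (cases "i = j") auto
  have "X j \<le> B" "- B \<le> X i" using X_box by (auto simp: box_def)
  then have "p i \<le> force X i" "force X j \<le> p j"
    using neg ij assms(2) by (auto intro!: force_ge force_le)
  moreover have "force X i \<le> force X j"
    unfolding force_def using neg m_pos
    by (intro sum_mono mult_left_mono sgn_mean_mono) (auto simp: less_imp_le)
  ultimately show False using p_decreasing[OF ij assms(2)] by linarith
qed

end

lemma telescope:
  fixes X :: "nat \<Rightarrow> real"
  assumes "i < N"
  shows "X i = X (N - 1) + (\<Sum>k=1..<N. (X (k - 1) - X k) * of_bool (i < k))"
proof -
  have "(\<Sum>k=1..<N. (X (k - 1) - X k) * of_bool (i < k)) = (\<Sum>k=Suc i..<N. X (k - 1) - X k)"
    by (rule sum.mono_neutral_cong_right) auto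
  also have "\<dots> = (\<Sum>k=i..<N - 1. X k - X (Suc k))"
    by (rule sum.reindex_bij_witness[of _ Suc "\<lambda>k. k - 1"]) auto
  also have "\<dots> = X i - X (N - 1)"
    using assms sum_Suc_diff'[of i "N - 1" "\<lambda>k. - X k"] by simp
  finally show ?thesis by simp
qed

lemma sum_of_bool_less: "k \<le> N \<Longrightarrow> (\<Sum>i<N. f i * of_bool (i < k)) = (\<Sum>i<k. f i :: real)"
  by (rule sum.mono_neutral_cong_right) auto

text \<open>Abel summation over the gaps of \<open>X\<close>. Since the energy of a minimiser is at most the energy \<open>0\<close> of a constant,
  this controls its gaps by \<open>moment\<close> alone, uniformly in the discretisation.\<close>

lemma energy_ge_gaps:
  assumes anti: "\<And>i j. i \<le> j \<Longrightarrow> j < N \<Longrightarrow> X j \<le> X i"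
  shows "(\<Sum>k=1..<N. (X (k - 1) - X k) * deficit k) - moment / 2 \<le> energy X"
proof -
  define g where "g k = X (k - 1) - X k" for k
  have g: "0 \<le> g k" if "k \<in> {1..<N}" for k
    using that anti[of "k - 1" k] by (auto simp: g_def)
  have tel: "X i = X (N - 1) + (\<Sum>k=1..<N. g k * of_bool (i < k))" if "i < N" for i
    unfolding g_def by (rule telescope[OF that])
  \<comment> \<open>The square is 1 exactly when \<open>k\<close> separates \<open>i\<close> from
    \<open>j\<close>. Written as a square it can be expanded, so that the double sum in
    \<open>sq\<close> factorises.\<close>
  have dist: "\<bar>X i - X j\<bar> = (\<Sum>k=1..<N. g k * (of_bool (i < k) - of_bool (j < k))\<^sup>2)" if "i < N" "j < N" for i j
  proof -
    have *: "\<bar>X i - X j\<bar> = (\<Sum>k=1..<N. g k * (of_bool (i < k) - of_bool (j < k))\<^sup>2)" if "i \<le> j" "i < N" "j < N" for i j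
    proof -
      have "\<bar>X i - X j\<bar> = (\<Sum>k=1..<N. g k * of_bool (i < k) - g k * of_bool (j < k))"
        unfolding sum_subtractf using tel[of i] tel[of j] that anti[of i j] by linarith
      also have "\<dots> = (\<Sum>k=1..<N. g k * (of_bool (i < k) - of_bool (j < k))\<^sup>2)"
        using that by (intro sum.cong) (auto simp: of_bool_def)
      finally show ?thesis .
    qed
    show ?thesis
    proof (cases "i \<le> j")
      case False
      then show ?thesis using *[of j i] that by (simp add: abs_minus_commute power2_commute)
    qed (use * that in auto)
  qed
  define t where "t k = (\<Sum>i<k. m i)" for k
  have sq: "(\<Sum>i<N. \<Sum>j<N. m i * m j * (of_bool (i < k) - of_bool (j < k))\<^sup>2) = 2 * t k * (1 - t k)"
    if "k \<le> N" for k
  proof -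
    have "(\<Sum>i<N. \<Sum>j<N. m i * m j * (of_bool (i < k) - of_bool (j < k))\<^sup>2) =
      (\<Sum>i<N. \<Sum>j<N. (m i * of_bool (i < k)) * m j + m i * (m j * of_bool (j < k)) -
         2 * ((m i * of_bool (i < k)) * (m j * of_bool (j < k))))"
      by (intro sum.cong refl) (auto simp: of_bool_def)
    also have "\<dots> = (\<Sum>i<N. m i * of_bool (i < k)) * (\<Sum>j<N. m j) + (\<Sum>i<N. m i) * (\<Sum>j<N. m j * of_bool (j < k))
       - 2 * ((\<Sum>i<N. m i * of_bool (i < k)) * (\<Sum>j<N. m j * of_bool (j < k)))"
      unfolding sum_product by (simp only: sum.distrib sum_subtractf sum_distrib_left)
    also have "\<dots> = 2 * t k * (1 - t k)"
      unfolding sum_of_bool_less[OF that] m_sum t_def by (simp add: algebra_simps)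
    finally show ?thesis .
  qed
  have "(\<Sum>i<N. \<Sum>j<N. m i * m j * \<bar>X i - X j\<bar>) =
      (\<Sum>i<N. \<Sum>j<N. \<Sum>k=1..<N. g k * (m i * m j * (of_bool (i < k) - of_bool (j < k))\<^sup>2))"
    by (intro sum.cong refl) (simp add: dist sum_distrib_left mult_ac)
  also have "\<dots> = (\<Sum>i<N. \<Sum>k=1..<N. \<Sum>j<N. g k * (m i * m j * (of_bool (i < k) - of_bool (j < k))\<^sup>2))"
    by (rule sum.cong[OF refl], rule sum.swap)
  also have "\<dots> = (\<Sum>k=1..<N. \<Sum>i<N. \<Sum>j<N. g k * (m i * m j * (of_bool (i < k) - of_bool (j < k))\<^sup>2))"
    by (rule sum.swap)
  also have "\<dots> = (\<Sum>k=1..<N. g k * (2 * t k * (1 - t k)))"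
    by (intro sum.cong refl) (simp add: sum_distrib_left[symmetric] sq)
  finally have quad: "(\<Sum>i<N. \<Sum>j<N. m i * m j * \<bar>X i - X j\<bar>) = (\<Sum>k=1..<N. g k * (2 * t k * (1 - t k)))" .
  have "(\<Sum>i<N. m i * p i * X i) =
      (\<Sum>i<N. m i * p i * X (N - 1) + (\<Sum>k=1..<N. g k * (m i * p i * of_bool (i < k))))"
  proof (intro sum.cong refl)
    fix i assume "i \<in> {..<N}"
    then show "m i * p i * X i = m i * p i * X (N - 1) + (\<Sum>k=1..<N. g k * (m i * p i * of_bool (i < k)))"
      by (subst tel, simp, simp only: sum_distrib_left distrib_left mult_ac)
  qed
  also have "\<dots> = (\<Sum>k=1..<N. \<Sum>i<N. g k * (m i * p i * of_bool (i < k)))"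
    by (subst sum.swap) (simp add: sum.distrib mp_sum sum_distrib_right[symmetric])
  also have "\<dots> = (\<Sum>k=1..<N. g k * (\<Sum>i<k. m i * p i))"
    by (intro sum.cong refl) (subst sum_distrib_left[symmetric], subst sum_of_bool_less, auto)
  finally have lin: "(\<Sum>i<N. m i * p i * X i) = (\<Sum>k=1..<N. g k * (\<Sum>i<k. m i * p i))" .
  have "(\<Sum>i<N. \<Sum>j<N. m i * m j * (\<bar>X i - X j\<bar> / 2 - moment)) \<le>
      (\<Sum>i<N. \<Sum>j<N. m i * m j * potential (X i - X j))"
    using m_pos by (intro sum_mono mult_left_mono potential_coercive) (auto simp: less_imp_le)
  moreover have "(\<Sum>i<N. \<Sum>j<N. m i * m j * (\<bar>X i - X j\<bar> / 2 - moment)) =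
      (\<Sum>i<N. \<Sum>j<N. m i * m j * \<bar>X i - X j\<bar>) / 2 - moment"
  proof -
    have "(\<Sum>i<N. \<Sum>j<N. m i * m j * (\<bar>X i - X j\<bar> / 2 - moment)) =
      (\<Sum>i<N. \<Sum>j<N. m i * m j * \<bar>X i - X j\<bar>) / 2 - (\<Sum>i<N. \<Sum>j<N. m i * m j) * moment"
      by (simp add: right_diff_distrib sum_subtractf sum_divide_distrib sum_distrib_right)
    then show ?thesis by (simp add: sum_product[symmetric] m_sum)
  qed
  ultimately have "(\<Sum>k=1..<N. g k * (2 * t k * (1 - t k))) / 4 - moment / 2 - (\<Sum>k=1..<N. g k * (\<Sum>i<k. m i * p i)) \<le> energy X"
    unfolding energy_def lin quad by linarith
  moreover have "(\<Sum>k=1..<N. g k * deficit k) =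
      (\<Sum>k=1..<N. g k * (2 * t k * (1 - t k))) / 4 - (\<Sum>k=1..<N. g k * (\<Sum>i<k. m i * p i))"
    unfolding sum_divide_distrib sum_subtractf[symmetric]
    by (intro sum.cong refl) (simp add: deficit_def t_def field_simps)
  ultimately show ?thesis by (simp add: g_def)
qed

text \<open>By \<open>mp_sum\<close> the linear term does not see translations.\<close>

lemma energy_shift: "energy (\<lambda>i. X i - c) = energy X"
  unfolding energy_def by (simp add: right_diff_distrib sum_subtractf mp_sum flip: sum_distrib_right)

text \<open>A minimiser in the box may touch a wall, but its spread is bounded through its gaps by
  less than \<open>B\<close>. Centring it keeps the energy and moves it off both walls, where both
  force inequalities hold.\<close>

theorem balance_exists:
  obtains X where "\<And>i j. i \<le> j \<Longrightarrow> j < N \<Longrightarrow> X j \<le> X i"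
    and "\<And>i. i < N \<Longrightarrow> force X i = p i"
    and "(\<Sum>k=1..<N. (X (k - 1) - X k) * deficit k) \<le> moment / 2"
proof -
  have deficit: "0 < deficit k" if "k \<in> {1..<N}" for k
    using that deficit_pos[of k] by (simp add: deficit_def)
  have moment: "0 \<le> moment" unfolding moment_def by (intro Bochner_Integration.integral_nonneg) (simp add: K_nonneg)
  obtain q where q: "0 < q" "\<And>k. k \<in> {1..<N} \<Longrightarrow> q \<le> deficit k"
  proof
    \<comment> \<open>The element 1 keeps the minimum defined when \<open>N = 1\<close>.\<close>
    let ?q = "Min (insert 1 (deficit ` {1..<N}))"
    show "0 < ?q" using deficit by (subst Min_gr_iff) auto
    show "?q \<le> deficit k" if "k \<in> {1..<N}" for k using that by (intro Min_le) auto
  qed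
  define B where "B = moment / q + 1"
  have B: "0 < B" using moment q(1) by (simp add: B_def add_nonneg_pos)
  obtain X where X: "X \<in> box B" "\<And>Y. Y \<in> box B \<Longrightarrow> energy X \<le> energy Y"
    using box_minimizer[of B] B by auto
  note anti = minimizer_antimono[OF X]
  have "energy X \<le> energy (\<lambda>_. 0)" using B by (intro X(2)) (simp add: box_def)
  also have "\<dots> = 0" by (simp add: energy_def potential_0)
  finally have gaps: "(\<Sum>k=1..<N. (X (k - 1) - X k) * deficit k) \<le> moment / 2"
    using energy_ge_gaps[of X, OF anti] by linarith
  have "(X 0 - X (N - 1)) * q = (\<Sum>k=1..<N. (X (k - 1) - X k) * q)"
    unfolding sum_distrib_right[symmetric]
    using telescope[OF N_pos, of X] sum.cong[of "{1..<N}" "{1..<N}" "\<lambda>k. (X (k - 1) - X k) * of_bool (0 < k)" "\<lambda>k. X (k - 1) - X k"]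
    by simp
  also have "\<dots> \<le> (\<Sum>k=1..<N. (X (k - 1) - X k) * deficit k)"
    using anti q(2) by (intro sum_mono mult_left_mono) (auto simp: Suc_le_eq)
  finally have "(X 0 - X (N - 1)) * q \<le> moment / 2" using gaps by linarith
  then have spread: "X 0 - X (N - 1) < B"
    using q(1) moment by (simp add: B_def field_simps)
  define c where "c = (X 0 + X (N - 1)) / 2"
  \<comment> \<open>The entries from \<open>N\<close> on are set to 0 because \<open>box\<close>
    constrains every coordinate.\<close>
  define Y where "Y i = (if i < N then X i - c else 0)" for i
  have Yb: "- B < Y i \<and> Y i < B" for i
  proof (cases "i < N")
    case True
    then have "X (N - 1) \<le> X i" "X i \<le> X 0" by (auto intro!: anti)
    then show ?thesis using True spread unfolding Y_def c_def by (simp add: field_simps)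
  qed (use B in \<open>simp add: Y_def\<close>)
  have "energy Y = energy (\<lambda>i. X i - c)"
    unfolding energy_def Y_def by simp
  then have Ymin: "energy Y \<le> energy Z" if "Z \<in> box B" for Z
    using X(2)[OF that] energy_shift by simp
  have Ybox: "Y \<in> box B" using Yb by (auto simp: box_def less_imp_le)
  show ?thesis
  proof
    show "Y j \<le> Y i" if "i \<le> j" "j < N" for i j
      by (rule minimizer_antimono[OF Ybox Ymin that])
    show "force Y i = p i" if "i < N" for i
      using force_ge[OF Ybox Ymin that] force_le[OF Ybox Ymin that] Yb[of i] by auto
    have "(\<Sum>k=1..<N. (Y (k - 1) - Y k) * deficit k) = (\<Sum>k=1..<N. (X (k - 1) - X k) * deficit k)"
      by (intro sum.cong) (auto simp: Y_def)
    then show "(\<Sum>k=1..<N. (Y (k - 1) - Y k) * deficit k) \<le> moment / 2"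
      using gaps by simp
  qed
qed

end

section \<open>Passage to the limit\<close>

lemma partition_block:
  fixes T :: "nat \<Rightarrow> 'a :: linorder"
  assumes "T 0 \<le> t" "t < T N"
  obtains j where "j < N" "T j \<le> t" "t < T (Suc j)"
  using assms
proof (induction N arbitrary: thesis)
  case (Suc N)
  show ?case
  proof (cases "t < T N")
    case True
    then show ?thesis using Suc.IH[OF _ Suc.prems(2)] Suc.prems(1) less_SucI by blast
  next
    case False
    then show ?thesis using Suc.prems(1)[of N] Suc.prems(3) by auto
  qed
qed simp

lemma continuous_at_right_of_bool:
  "continuous (at_right x) (\<lambda>t. of_bool (a \<le> t) :: real)" for a x :: real
proof -
  have "\<forall>\<^sub>F t in at_right x. (of_bool (a \<le> t) :: real) = of_bool (a \<le> x)"
  proof (cases "a \<le> x")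
    case True
    then show ?thesis by (auto simp: eventually_at_right_field intro!: exI[of _ "x + 1"])
  next
    case False
    then show ?thesis by (auto simp: eventually_at_right_field intro!: exI[of _ a])
  qed
  then show ?thesis unfolding continuous_within by (rule tendsto_eventually)
qed

context kernel
begin

lemma mean_tail_shift: "mean_tail (\<lambda>s. X s - c) (x - c) = mean_tail X x"
  by (simp add: mean_tail_def)

text \<open>The discrete problem on a partition \<open>T\<close>: masses are cell lengths and
  \<open>p i\<close> is the mean slope of \<open>P\<close> on a cell, so partial sums telescope to
  \<open>T k\<close> and \<open>P (T k)\<close>. The last conclusion bounds \<open>X\<close>
  independently of the partition.\<close>

lemma step_balance:
  fixes T P :: "_ \<Rightarrow> real"
  assumes N: "0 < N" and T0: "T 0 = 0" and TN: "T N = 1"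
    and T_less: "\<And>k. k < N \<Longrightarrow> T k < T (Suc k)"
    and P0: "P 0 = 0" and P1: "P 1 = 0"
    and P_less: "\<And>t. 0 < t \<Longrightarrow> t < 1 \<Longrightarrow> P t < t * (1 - t) / 2"
    and slopes: "\<And>i j. i < j \<Longrightarrow> j < N \<Longrightarrow>
      (P (T (Suc j)) - P (T j)) / (T (Suc j) - T j) < (P (T (Suc i)) - P (T i)) / (T (Suc i) - T i)"
  obtains X :: "real \<Rightarrow> real" where "antimono X" "\<And>x. continuous (at_right x) X"
    and "\<And>i s t. i < N \<Longrightarrow> s \<in> {T i..<T (Suc i)} \<Longrightarrow> t \<in> {T i..<T (Suc i)} \<Longrightarrow> X s = X t"
    and "\<And>i t. i < N \<Longrightarrow> t \<in> {T i..<T (Suc i)} \<Longrightarrow>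
      mean_tail X (X t) = 1/2 - (P (T (Suc i)) - P (T i)) / (T (Suc i) - T i)"
    and "\<And>a b q. a \<le> b \<Longrightarrow> 0 < q \<Longrightarrow> (\<And>t. a < t \<Longrightarrow> t \<le> b \<Longrightarrow> 0 < t \<Longrightarrow> t < 1 \<Longrightarrow> q \<le> t * (1 - t) / 2 - P t) \<Longrightarrow>
      X a - X b \<le> moment / (2 * q)"
proof -
  define m where "m i = T (Suc i) - T i" for i
  define p where "p i = (P (T (Suc i)) - P (T i)) / m i" for i
  have m_pos: "0 < m i" if "i < N" for i using T_less[OF that] by (simp add: m_def)
  have m_psum: "(\<Sum>i<k. m i) = T k" for k
    using sum_lessThan_telescope[of T k] by (simp add: m_def T0)
  have mp_psum: "(\<Sum>i<k. m i * p i) = P (T k)" if "k \<le> N" for k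
  proof -
    have "(\<Sum>i<k. m i * p i) = (\<Sum>i<k. P (T (Suc i)) - P (T i))"
    proof (rule sum.cong[OF refl])
      fix i assume "i \<in> {..<k}"
      then show "m i * p i = P (T (Suc i)) - P (T i)" using m_pos[of i] that by (simp add: p_def)
    qed
    also have "\<dots> = P (T k)" using sum_lessThan_telescope[of "\<lambda>i. P (T i)" k] by (simp add: T0 P0)
    finally show ?thesis .
  qed
  have T_mono: "T i < T j" if "i < j" "j \<le> N" for i j
    using that
  proof (induction j)
    case (Suc j)
    then show ?case using T_less[of j] by (cases "i = j") auto
  qed simp
  have T_le: "T i \<le> T j" if "i \<le> j" "j \<le> N" for i j
    using T_mono[of i j] that by (cases "i = j") auto
  have T_inner: "0 < T k" "T k < 1" if "0 < k" "k < N" for k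
    using T_mono[of 0 k] T_mono[of k N] that T0 TN by auto
  interpret discrete_balance K N m p
  proof
    show "(\<Sum>i<k. m i * p i) < (\<Sum>i<k. m i) * (1 - (\<Sum>i<k. m i)) / 2" if "0 < k" "k < N" for k
      using that T_inner[of k] P_less by (simp add: m_psum mp_psum)
  qed (use N m_pos m_psum mp_psum TN P1 slopes in \<open>auto simp: p_def m_def\<close>)
  obtain x where anti: "\<And>i j. i \<le> j \<Longrightarrow> j < N \<Longrightarrow> x j \<le> x i"
    and bal: "\<And>i. i < N \<Longrightarrow> force x i = p i"
    and gaps: "(\<Sum>k=1..<N. (x (k - 1) - x k) * deficit k) \<le> moment / 2"
    using balance_exists by blast
  \<comment> \<open>As a sum of right-continuous steps \<open>X\<close> is decreasing and
    right-continuous on the whole line, as Helly's theorem requires.\<close>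
  define X where "X t = x 0 - (\<Sum>k=1..<N. (x (k - 1) - x k) * of_bool (T k \<le> t))" for t
  have gap: "0 \<le> x (k - 1) - x k" if "k \<in> {1..<N}" for k
    using that anti[of "k - 1" k] by auto
  have Xeq: "X t = x i" if i: "i < N" and t: "t \<in> {T i..<T (Suc i)}" for i t
  proof -
    have "T k \<le> t \<longleftrightarrow> k \<le> i" if "k < N" for k
    proof
      assume "T k \<le> t"
      then show "k \<le> i" using t T_mono[of "Suc i" k] that i
        by (cases "k = Suc i") (auto simp: not_le[symmetric] intro: ccontr)
    next
      assume "k \<le> i"
      then show "T k \<le> t" using t T_mono[of k i] i by (cases "k = i") auto
    qed
    then have "(\<Sum>k=1..<N. (x (k - 1) - x k) * of_bool (T k \<le> t)) = (\<Sum>k=1..<Suc i. x (k - 1) - x k)"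
      using i by (intro sum.mono_neutral_cong_right) auto
    also have "\<dots> = (\<Sum>k<i. x k - x (Suc k))"
      by (rule sum.reindex_bij_witness[of _ Suc "\<lambda>k. k - 1"]) auto
    also have "\<dots> = x 0 - x i"
      using sum_lessThan_telescope'[of x i] by simp
    finally show ?thesis by (simp add: X_def)
  qed
  show ?thesis
  proof
    show "antimono X"
    proof (rule antimonoI)
      fix s t :: real assume "s \<le> t"
      then have "(\<Sum>k=1..<N. (x (k - 1) - x k) * of_bool (T k \<le> s)) \<le> (\<Sum>k=1..<N. (x (k - 1) - x k) * of_bool (T k \<le> t))"
        by (intro sum_mono mult_left_mono gap) auto
      then show "X t \<le> X s" by (simp only: X_def diff_left_mono)
    qed
    show "continuous (at_right y) X" for y
      unfolding X_def[abs_def] by (intro continuous_intros continuous_at_right_of_bool)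
    show "X s = X t" if "i < N" "s \<in> {T i..<T (Suc i)}" "t \<in> {T i..<T (Suc i)}" for i s t
      using Xeq that by simp
    have mean: "mean_tail X y = (\<Sum>j<N. m j * tail (y - x j))" for y
    proof -
      let ?i = "\<lambda>t. indicator {..<t} :: real \<Rightarrow> real"
      have "mean_tail X y = (LINT s|unit_measure. (\<Sum>j<N. (?i (T (Suc j)) s - ?i (T j) s) * tail (y - x j)))"
        unfolding mean_tail_def
      proof (rule Bochner_Integration.integral_cong[OF refl])
        fix s assume "s \<in> space unit_measure"
        then have "T 0 \<le> s" "s < T N" using T0 TN by auto
        then obtain i where i: "i < N" "T i \<le> s" "s < T (Suc i)" by (rule partition_block)
        have "(\<Sum>j<N. (?i (T (Suc j)) s - ?i (T j) s) * tail (y - x j)) =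
          (\<Sum>j<N. if j = i then tail (y - x j) else 0)"
        proof (rule sum.cong[OF refl])
          fix j assume "j \<in> {..<N}"
          then show "(?i (T (Suc j)) s - ?i (T j) s) * tail (y - x j) = (if j = i then tail (y - x j) else 0)"
          proof (cases j i rule: linorder_cases)
            case less
            then have "T j \<le> s" "T (Suc j) \<le> s" using T_le[of j i] T_le[of "Suc j" i] i by auto
            then show ?thesis using less by simp
          next
            case greater
            then have "s < T j" "s < T (Suc j)"
              using T_le[of "Suc i" j] T_le[of "Suc i" "Suc j"] i \<open>j \<in> {..<N}\<close> by auto
            then show ?thesis using greater by simp
          qed (use i in simp)
        qed
        then show "tail (y - X s) = (\<Sum>j<N. (?i (T (Suc j)) s - ?i (T j) s) * tail (y - x j))"
          using i by (simp add: Xeq[of i])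
      qed
      also have "\<dots> = (\<Sum>j<N. m j * tail (y - x j))"
      proof -
        have T01: "0 \<le> T j" "T j \<le> 1" if "j \<le> N" for j
          using that T_mono[of 0 j] T_mono[of j N] T0 TN
          by (cases "j = 0"; cases "j = N"; auto)+
        have int: "integrable unit_measure (?i t)" for t
          by (rule unit_measure.integrable_const_bound[where B = 1]) (auto intro!: borel_measurable_unit_measure)
        have "(LINT s|unit_measure. ?i (T j) s) = T j" if "j \<le> N" for j
          using unit_measure_lessThan[OF T01[OF that]] by simp
        then have *: "(LINT s|unit_measure. (?i (T (Suc j)) s - ?i (T j) s) * tail (y - x j)) = m j * tail (y - x j)" if "j < N" for j
          using that by (simp add: Bochner_Integration.integral_diff[OF int int] m_def del: integral_indicator)
        have "(LINT s|unit_measure. (\<Sum>j<N. (?i (T (Suc j)) s - ?i (T j) s) * tail (y - x j))) =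
            (\<Sum>j<N. LINT s|unit_measure. (?i (T (Suc j)) s - ?i (T j) s) * tail (y - x j))"
          by (intro Bochner_Integration.integral_sum integrable_mult_left impI Bochner_Integration.integrable_diff int)
        also have "\<dots> = (\<Sum>j<N. m j * tail (y - x j))"
          by (rule sum.cong) (simp_all only: * lessThan_iff)
        finally show ?thesis .
      qed
      finally show ?thesis .
    qed
    show "mean_tail X (X t) = 1/2 - (P (T (Suc i)) - P (T i)) / (T (Suc i) - T i)"
      if "i < N" "t \<in> {T i..<T (Suc i)}" for i t
    proof -
      have "force x i = (\<Sum>j<N. m j * (1/2)) - (\<Sum>j<N. m j * tail (x i - x j))"
        by (simp add: force_def sgn_mean_def right_diff_distrib sum_subtractf)
      then have "p i = 1/2 - mean_tail X (x i)"
        using bal[OF that(1)] by (simp add: mean sum_distrib_right[symmetric] m_psum TN flip: sum_divide_distrib)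
      then show ?thesis using Xeq[OF that] by (simp add: p_def m_def)
    qed
    show "X a - X b \<le> moment / (2 * q)" if ab: "a \<le> b" and q: "0 < q"
      and Q: "\<And>t. a < t \<Longrightarrow> t \<le> b \<Longrightarrow> 0 < t \<Longrightarrow> t < 1 \<Longrightarrow> q \<le> t * (1 - t) / 2 - P t" for a b q
    proof -
      \<comment> \<open>Only jumps at points \<open>T k\<close> in \<open>{a<..b}\<close>
        contribute, and there \<open>q\<close> is at most the deficit. The other gaps add
        nonnegative terms on the right.\<close>
      have "(X a - X b) * q = (\<Sum>k=1..<N. ((x (k - 1) - x k) * of_bool (T k \<le> b) - (x (k - 1) - x k) * of_bool (T k \<le> a)) * q)"
        unfolding X_def sum_distrib_right[symmetric] sum_subtractf by simp
      also have "\<dots> \<le> (\<Sum>k=1..<N. (x (k - 1) - x k) * deficit k)"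
      proof (rule sum_mono)
        fix k assume k: "k \<in> {1..<N}"
        then have d: "deficit k = T k * (1 - T k) / 2 - P (T k)"
          by (simp add: deficit_def m_psum mp_psum)
        have pos: "0 \<le> deficit k" using deficit_pos[of k] k by (simp add: deficit_def)
        show "((x (k - 1) - x k) * of_bool (T k \<le> b) - (x (k - 1) - x k) * of_bool (T k \<le> a)) * q
            \<le> (x (k - 1) - x k) * deficit k"
        proof (cases "a < T k \<and> T k \<le> b")
          case True
          then have "q \<le> deficit k" unfolding d using T_inner[of k] k by (intro Q) auto
          then show ?thesis using True gap[OF k] by (auto intro!: mult_left_mono)
        next
          case False
          then show ?thesis using ab gap[OF k] pos by auto
        qed
      qed
      finally show ?thesis using gaps q by (simp add: field_simps)
    qed
  qed
qed

end

section \<open>Discretising a profile with one flat piece\<close>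

lemma integral_mean_value:
  fixes p :: "real \<Rightarrow> real"
  assumes p: "continuous_on {0..1} p" and ab: "0 \<le> a" "a < b" "b \<le> 1"
  obtains \<xi> where "a < \<xi>" "\<xi> < b" "(integral {0..b} p - integral {0..a} p) / (b - a) = p \<xi>"
proof -
  have der: "((\<lambda>t. integral {0..t} p) has_real_derivative p x) (at x within {0..1})" if "x \<in> {0..1}" for x
    by (rule integral_has_real_derivative[OF p that])
  have "((\<lambda>t. integral {0..t} p) has_derivative (\<lambda>h. h * p x)) (at x within {a..b})" if "a \<le> x" "x \<le> b" for x
  proof -
    have "((\<lambda>t. integral {0..t} p) has_derivative (\<lambda>h. p x * h)) (at x within {a..b})"
      using der[of x] that ab unfolding has_field_derivative_def
      by (auto intro: has_derivative_subset)
    then show ?thesis by (simp add: mult.commute)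
  qed
  from mvt_simple[OF ab(2) this]
  have "\<exists>\<xi>\<in>{a<..<b}. integral {0..b} p - integral {0..a} p = (b - a) * p \<xi>" .
  then show ?thesis using that ab(2) by auto
qed

text \<open>The profile \<open>p\<close> prescribes \<open>1/2 - mean_tail X (X t)\<close>. Then
  \<open>p_mean\<close> is the equal-area condition, and \<open>p_less\<close> is the continuous
  form of \<open>deficit_pos\<close>.\<close>

locale flat_profile = kernel +
  fixes p :: "real \<Rightarrow> real" and u1 u2 :: real
  assumes p_cont: "continuous_on {0..1} p"
    and u: "0 < u1" "u1 < u2" "u2 < 1"
    and p_decr_left: "\<And>s t. 0 \<le> s \<Longrightarrow> s < t \<Longrightarrow> t \<le> u1 \<Longrightarrow> p t < p s"
    and p_decr_right: "\<And>s t. u2 \<le> s \<Longrightarrow> s < t \<Longrightarrow> t \<le> 1 \<Longrightarrow> p t < p s"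
    and p_flat: "\<And>t. u1 \<le> t \<Longrightarrow> t \<le> u2 \<Longrightarrow> p t = p u1"
    and p_mean: "integral {0..1} p = 0"
    and p_less: "\<And>t. 0 < t \<Longrightarrow> t < 1 \<Longrightarrow> integral {0..t} p < t * (1 - t) / 2"
begin

lemma p_decr:
  assumes "0 \<le> s" "s < t" "t \<le> 1" "s < u1 \<or> u2 < t"
  shows "p t < p s"
proof -
  have l: "p (min t u1) \<le> p (min s u1)" using p_decr_left[of "min s u1" "min t u1"] assms u
    by (cases "min s u1 < min t u1") (auto simp: min_def split: if_splits)
  have r: "p (max t u2) \<le> p (max s u2)" using p_decr_right[of "max s u2" "max t u2"] assms u
    by (cases "max s u2 < max t u2") (auto simp: max_def split: if_splits)
  consider "t \<le> u1" | "u2 \<le> s" | "s < u1" "u1 < t" | "u1 \<le> s" "s < u2" "u2 < t"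
    using assms u by linarith
  then show ?thesis
  proof cases
    case 3
    have "p t \<le> p u1"
      using r 3 u p_flat[of t] p_flat[of u2] by (cases "t \<le> u2") (auto simp: max_def)
    then show ?thesis using p_decr_left[of s u1] 3 assms by linarith
  next
    case 4
    then show ?thesis using p_decr_right[of u2 t] p_flat[of s] p_flat[of u2] assms u by auto
  qed (use assms p_decr_left p_decr_right in auto)
qed

text \<open>Here \<open>p\<close> is replaced by its cell averages, which are values
  \<open>p \<xi>\<close>. The flat piece is a single cell, so the averages stay strictly decreasing
  and \<open>X\<close> is constant there; a translation makes this constant 0. The alternative
  \<open>p \<xi> = p t\<close> covers that cell, whose width does not shrink with
  \<open>n\<close>.\<close>

lemma approx_quantile:
  fixes n :: nat
  assumes n: "0 < n"
  obtains X :: "real \<Rightarrow> real" where "antimono X" "\<And>x. continuous (at_right x) X"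
    and "\<And>t. t \<in> {u1..<u2} \<Longrightarrow> X t = 0"
    and "\<And>t. 0 \<le> t \<Longrightarrow> t < 1 \<Longrightarrow> \<exists>\<xi>\<in>{0..1}. mean_tail X (X t) = 1/2 - p \<xi> \<and> (\<bar>\<xi> - t\<bar> \<le> 1 / n \<or> p \<xi> = p t)"
    and "\<And>a b q. a \<le> b \<Longrightarrow> 0 < q \<Longrightarrow> (\<And>t. a < t \<Longrightarrow> t \<le> b \<Longrightarrow> 0 < t \<Longrightarrow> t < 1 \<Longrightarrow> q \<le> t * (1 - t) / 2 - integral {0..t} p) \<Longrightarrow>
      X a - X b \<le> moment / (2 * q)"
proof -
  \<comment> \<open>There are \<open>n\<close> equal cells on \<open>{0..u1}\<close>, then cell
    number \<open>n\<close>, which is \<open>{u1..u2}\<close>, then \<open>n\<close> equal cells on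
    \<open>{u2..1}\<close>.\<close>
  define T where "T k = (if k \<le> n then u1 * real k / n else u2 + (1 - u2) * (real k - n - 1) / n)" for k
  define N where "N = 2 * n + 1"
  have T0: "T 0 = 0" and TN: "T N = 1" and Tn: "T n = u1" "T (Suc n) = u2"
    using n by (auto simp: T_def N_def)
  have width: "T (Suc k) - T k = (if k < n then u1 / n else if k = n then u2 - u1 else (1 - u2) / n)" for k
    using n by (cases k n rule: linorder_cases) (auto simp: T_def field_simps)
  have T_less: "T k < T (Suc k)" for k
  proof -
    have "0 < T (Suc k) - T k" using width[of k] u n by auto
    then show ?thesis by simp
  qed
  have T_mono: "T i \<le> T j" if "i \<le> j" for i j
    by (rule lift_Suc_mono_le[of T, OF _ that]) (rule less_imp_le[OF T_less])
  have T_range: "0 \<le> T i" "T i \<le> 1" if "i \<le> N" for i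
    using T_mono[of 0 i] T_mono[of i N] that T0 TN by auto
  have avg: "\<exists>\<xi>. T i < \<xi> \<and> \<xi> < T (Suc i) \<and>
      (integral {0..T (Suc i)} p - integral {0..T i} p) / (T (Suc i) - T i) = p \<xi>" if "i < N" for i
    by (rule integral_mean_value[OF p_cont, of "T i" "T (Suc i)"])
      (use T_less[of i] T_range[of i] T_range[of "Suc i"] that in auto)
  have slopes: "(integral {0..T (Suc j)} p - integral {0..T j} p) / (T (Suc j) - T j) <
      (integral {0..T (Suc i)} p - integral {0..T i} p) / (T (Suc i) - T i)" if ij: "i < j" "j < N" for i j
  proof -
    obtain x where x: "T i < x" "x < T (Suc i)" "(integral {0..T (Suc i)} p - integral {0..T i} p) / (T (Suc i) - T i) = p x"
      using avg[of i] ij by auto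
    obtain y where y: "T j < y" "y < T (Suc j)" "(integral {0..T (Suc j)} p - integral {0..T j} p) / (T (Suc j) - T j) = p y"
      using avg[of j] ij by auto
    have xy: "x < y" "0 \<le> x" "y \<le> 1"
      using x y T_mono[of "Suc i" j] T_range[of i] T_range[of "Suc j"] ij by auto
    \<comment> \<open>Two different cells cannot both be the middle one, so \<open>p_decr\<close>
      gives a strict inequality.\<close>
    have "x < u1 \<or> u2 < y"
    proof (cases "i < n")
      case True
      then show ?thesis using x(2) T_mono[of "Suc i" n] Tn by auto
    next
      case False
      then show ?thesis using y(1) T_mono[of "Suc n" j] Tn ij by auto
    qed
    then show ?thesis using p_decr xy x(3) y(3) by simp
  qed
  show ?thesis
  proof (rule step_balance[of N T "\<lambda>t. integral {0..t} p", OF _ T0 TN T_less _ p_mean p_less slopes])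
    fix Y :: "real \<Rightarrow> real"
    assume Y: "antimono Y" "\<And>x. continuous (at_right x) Y"
      and const: "\<And>i s t. i < N \<Longrightarrow> s \<in> {T i..<T (Suc i)} \<Longrightarrow> t \<in> {T i..<T (Suc i)} \<Longrightarrow> Y s = Y t"
      and bal: "\<And>i t. i < N \<Longrightarrow> t \<in> {T i..<T (Suc i)} \<Longrightarrow>
        mean_tail Y (Y t) = 1/2 - (integral {0..T (Suc i)} p - integral {0..T i} p) / (T (Suc i) - T i)"
      and bound: "\<And>a b q. a \<le> b \<Longrightarrow> 0 < q \<Longrightarrow> (\<And>t. a < t \<Longrightarrow> t \<le> b \<Longrightarrow> 0 < t \<Longrightarrow> t < 1 \<Longrightarrow> q \<le> t * (1 - t) / 2 - integral {0..t} p) \<Longrightarrow>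
        Y a - Y b \<le> moment / (2 * q)"
    show thesis
    proof
      let ?X = "\<lambda>t. Y t - Y u1"
      show "antimono ?X" using Y(1) by (simp add: antimono_def)
      show "continuous (at_right x) ?X" for x by (intro continuous_intros Y)
      show "?X t = 0" if "t \<in> {u1..<u2}" for t
        using const[of n t u1] that Tn u by (simp add: N_def)
      show "\<exists>\<xi>\<in>{0..1}. mean_tail ?X (?X t) = 1/2 - p \<xi> \<and> (\<bar>\<xi> - t\<bar> \<le> 1 / n \<or> p \<xi> = p t)" if t: "0 \<le> t" "t < 1" for t
      proof -
        obtain i where i: "i < N" "T i \<le> t" "t < T (Suc i)"
          using partition_block[of T t N] t T0 TN by auto
        obtain \<xi> where x: "T i < \<xi>" "\<xi> < T (Suc i)" "(integral {0..T (Suc i)} p - integral {0..T i} p) / (T (Suc i) - T i) = p \<xi>"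
          using avg[of i] i by auto
        have "mean_tail ?X (?X t) = 1/2 - p \<xi>"
          using bal[of i t] i x(3) by (simp add: mean_tail_shift)
        moreover have "\<bar>\<xi> - t\<bar> \<le> 1 / n \<or> p \<xi> = p t"
        proof (cases "i = n")
          case True
          then show ?thesis using p_flat[of \<xi>] p_flat[of t] x i Tn by auto
        next
          case False
          then have "T (Suc i) - T i \<le> 1 / n" using width[of i] u n by (auto intro: divide_right_mono)
          then show ?thesis using x i by auto
        qed
        moreover have "\<xi> \<in> {0..1}" using x T_range[of i] T_range[of "Suc i"] i by auto
        ultimately show ?thesis by blast
      qed
      show "?X a - ?X b \<le> moment / (2 * q)"
        if "a \<le> b" "0 < q" "\<And>t. a < t \<Longrightarrow> t \<le> b \<Longrightarrow> 0 < t \<Longrightarrow> t < 1 \<Longrightarrow> q \<le> t * (1 - t) / 2 - integral {0..t} p" for a b q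
        using bound[OF that] by simp
    qed
  qed (simp_all add: N_def)
qed

end

lemma AE_unit_measure_countable:
  assumes "countable D"
  shows "AE s in unit_measure. s \<notin> D"
proof -
  have "AE s in lborel. s \<notin> D"
    by (rule AE_not_in) (use countable_imp_null_set_lborel[OF assms] in simp)
  then show ?thesis
    unfolding unit_measure_def by (subst AE_restrict_space_iff) (auto elim: eventually_mono)
qed

lemma continuity_points_dense:
  fixes F :: "real \<Rightarrow> real"
  assumes "mono F" "a < b"
  obtains c where "a < c" "c < b" "isCont F c"
proof -
  have "\<not> {a<..<b} \<subseteq> {c. \<not> isCont F c}"
    using mono_ctble_discont[OF assms(1)] countable_subset uncountable_open_interval assms(2) by blast
  then show ?thesis using that by auto
qed

context flat_profile
begin

lemma p_tendsto_right:
  assumes "0 \<le> t" "t < 1"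
  shows "(p \<longlongrightarrow> p t) (at_right t)"
proof -
  have "(p \<longlongrightarrow> p t) (at t within {t..1})"
    by (rule tendsto_within_subset[of _ _ _ "{0..1}"]) (use p_cont assms in \<open>auto simp: continuous_on\<close>)
  then show ?thesis using at_within_Icc_at_right[of t 1] assms by simp
qed

lemma p_tendsto_left:
  assumes "0 < t" "t \<le> 1"
  shows "(p \<longlongrightarrow> p t) (at_left t)"
proof -
  have "(p \<longlongrightarrow> p t) (at t within {0..t})"
    by (rule tendsto_within_subset[of _ _ _ "{0..1}"]) (use p_cont assms in \<open>auto simp: continuous_on\<close>)
  then show ?thesis using at_within_Icc_at_left[of 0 t] assms by simp
qed

text \<open>Between \<open>t\<close> and \<open>u1\<close> the continuous deficit has a positive
  minimum, because this compact interval stays inside the open unit interval. The gap bound with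
  that minimum as \<open>q\<close> and \<open>X u1 = 0\<close> control \<open>X t\<close>, uniformly
  in \<open>X\<close>.\<close>

lemma approx_quantiles_locally_bounded:
  assumes t: "0 < t" "t < 1"
  obtains C where "\<And>X :: real \<Rightarrow> real. antimono X \<Longrightarrow> X u1 = 0 \<Longrightarrow>
    (\<And>a b q. a \<le> b \<Longrightarrow> 0 < q \<Longrightarrow> (\<And>t. a < t \<Longrightarrow> t \<le> b \<Longrightarrow> 0 < t \<Longrightarrow> t < 1 \<Longrightarrow> q \<le> t * (1 - t) / 2 - integral {0..t} p) \<Longrightarrow>
      X a - X b \<le> moment / (2 * q)) \<Longrightarrow> \<bar>X t\<bar> \<le> C"
proof -
  define a b where "a = min t u1" and "b = max t u1"
  have ab: "0 < a" "a \<le> b" "b < 1" using t u by (auto simp: a_def b_def)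
  let ?Q = "\<lambda>t. t * (1 - t) / 2 - integral {0..t} p"
  have "continuous_on {0..1} (\<lambda>t. integral {0..t} p)"
    by (intro indefinite_integral_continuous_1 integrable_continuous_real p_cont)
  then have "continuous_on {a..b} (\<lambda>t. integral {0..t} p)"
    by (rule continuous_on_subset) (use ab in auto)
  then have "continuous_on {a..b} ?Q" by (intro continuous_intros) auto
  then obtain z where z: "z \<in> {a..b}" "\<And>y. y \<in> {a..b} \<Longrightarrow> ?Q z \<le> ?Q y"
    using continuous_attains_inf[of "{a..b}" ?Q] ab by auto
  have q: "0 < ?Q z" using p_less[of z] z ab by auto
  show ?thesis
  proof (rule that[of "moment / (2 * ?Q z)"])
    fix X :: "real \<Rightarrow> real"
    assume X: "antimono X" "X u1 = 0"
      and bound: "\<And>a b q. a \<le> b \<Longrightarrow> 0 < q \<Longrightarrow> (\<And>t. a < t \<Longrightarrow> t \<le> b \<Longrightarrow> 0 < t \<Longrightarrow> t < 1 \<Longrightarrow> q \<le> ?Q t) \<Longrightarrow>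
      X a - X b \<le> moment / (2 * q)"
    have "X a - X b \<le> moment / (2 * ?Q z)"
      by (rule bound[OF ab(2) q]) (use z in auto)
    moreover have "X b \<le> X t" "X t \<le> X a" "X b \<le> X u1" "X u1 \<le> X a"
      using X(1) by (auto simp: antimono_def a_def b_def)
    moreover have "X a = X u1 \<or> X a = X t" "X b = X u1 \<or> X b = X t" by (auto simp: a_def b_def min_def max_def)
    ultimately show "\<bar>X t\<bar> \<le> moment / (2 * ?Q z)" using X(2) by (cases "t \<le> u1") (auto simp: a_def b_def)
  qed
qed

text \<open>Helly's theorem is applied to \<open>arctan (- Y n t)\<close>; the local bounds keep the limit away from \<open>\<plusminus> pi / 2\<close>.\<close>

theorem quantile_exists:
  obtains X :: "real \<Rightarrow> real" where "antimono_on {0<..<1} X"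
    and "\<And>t. 0 < t \<Longrightarrow> t < 1 \<Longrightarrow> continuous (at_right t) X"
    and "\<And>t. u1 < t \<Longrightarrow> t < u2 \<Longrightarrow> X t = 0"
    and "\<And>t. 0 < t \<Longrightarrow> t < 1 \<Longrightarrow> mean_tail X (X t) = 1/2 - p t"
proof -
  have "\<exists>X :: real \<Rightarrow> real. antimono X \<and> (\<forall>x. continuous (at_right x) X) \<and> (\<forall>t\<in>{u1..<u2}. X t = 0) \<and>
     (\<forall>t. 0 \<le> t \<longrightarrow> t < 1 \<longrightarrow> (\<exists>\<xi>\<in>{0..1}. mean_tail X (X t) = 1/2 - p \<xi> \<and> (\<bar>\<xi> - t\<bar> \<le> 1 / real (Suc n) \<or> p \<xi> = p t))) \<and>
     (\<forall>a b q. a \<le> b \<longrightarrow> 0 < q \<longrightarrow> (\<forall>t. a < t \<longrightarrow> t \<le> b \<longrightarrow> 0 < t \<longrightarrow> t < 1 \<longrightarrow> q \<le> t * (1 - t) / 2 - integral {0..t} p) \<longrightarrow>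
      X a - X b \<le> moment / (2 * q))" (is "\<exists>X. ?good n X") for n
  proof (rule approx_quantile[of "Suc n"])
    fix X :: "real \<Rightarrow> real"
    assume X: "antimono X" "\<And>x. continuous (at_right x) X" "\<And>t. t \<in> {u1..<u2} \<Longrightarrow> X t = 0"
      "\<And>t. 0 \<le> t \<Longrightarrow> t < 1 \<Longrightarrow> \<exists>\<xi>\<in>{0..1}. mean_tail X (X t) = 1/2 - p \<xi> \<and> (\<bar>\<xi> - t\<bar> \<le> 1 / real (Suc n) \<or> p \<xi> = p t)"
      "\<And>a b q. a \<le> b \<Longrightarrow> 0 < q \<Longrightarrow> (\<And>t. a < t \<Longrightarrow> t \<le> b \<Longrightarrow> 0 < t \<Longrightarrow> t < 1 \<Longrightarrow> q \<le> t * (1 - t) / 2 - integral {0..t} p) \<Longrightarrow>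
      X a - X b \<le> moment / (2 * q)"
    show "\<exists>X. ?good n X"
      by (rule exI[of _ X], intro conjI allI ballI impI)
       (rule X(1), rule X(2), rule X(3), assumption, rule X(4), assumption, assumption, rule X(5), assumption, assumption, blast)
  qed simp
  then have "\<forall>n. \<exists>X. ?good n X" by (rule allI)
  then obtain Y where "\<forall>n. ?good n (Y n)" by (rule choice[THEN exE])
  note Y = this[THEN spec]
  have Y_anti: "antimono (Y n)" for n
    using Y[of n] by (elim conjE)
  have Y_right: "continuous (at_right x) (Y n)" for n x
    using Y[of n] by (elim conjE) (erule spec)
  have Y_flat: "Y n t = 0" if "t \<in> {u1..<u2}" for n t
    using Y[of n] that by (elim conjE) (erule bspec)
  have Y_bal: "\<exists>\<xi>\<in>{0..1}. mean_tail (Y n) (Y n t) = 1/2 - p \<xi> \<and> (\<bar>\<xi> - t\<bar> \<le> 1 / real (Suc n) \<or> p \<xi> = p t)"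
    if "0 \<le> t" "t < 1" for n t
    using Y[of n] that by (elim conjE) (drule spec, drule mp, assumption, erule mp)
  have Y_gap: "Y n a - Y n b \<le> moment / (2 * q)"
    if "a \<le> b" "0 < q" "\<And>t. a < t \<Longrightarrow> t \<le> b \<Longrightarrow> 0 < t \<Longrightarrow> t < 1 \<Longrightarrow> q \<le> t * (1 - t) / 2 - integral {0..t} p" for n a b q
    using Y[of n, THEN conjunct2, THEN conjunct2, THEN conjunct2, THEN conjunct2, rule_format, OF that] .
  have Y_bound: "\<exists>C. \<forall>n. \<bar>Y n t\<bar> \<le> C" if "0 < t" "t < 1" for t
  proof (rule approx_quantiles_locally_bounded[OF that])
    fix C
    assume C: "\<And>X :: real \<Rightarrow> real. antimono X \<Longrightarrow> X u1 = 0 \<Longrightarrow>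
    (\<And>a b q. a \<le> b \<Longrightarrow> 0 < q \<Longrightarrow> (\<And>t. a < t \<Longrightarrow> t \<le> b \<Longrightarrow> 0 < t \<Longrightarrow> t < 1 \<Longrightarrow> q \<le> t * (1 - t) / 2 - integral {0..t} p) \<Longrightarrow>
      X a - X b \<le> moment / (2 * q)) \<Longrightarrow> \<bar>X t\<bar> \<le> C"
    have "\<bar>Y n t\<bar> \<le> C" for n
      by (rule C[OF Y_anti _ Y_gap]) (use Y_flat[of u1 n] u in auto)
    then show "\<exists>C. \<forall>n. \<bar>Y n t\<bar> \<le> C" by blast
  qed
  let ?F = "\<lambda>n t. arctan (- Y n t)"
  have "\<exists>r. strict_mono (r :: nat \<Rightarrow> nat) \<and> (\<exists>F. (\<forall>x. continuous (at_right x) F) \<and> mono F \<and> (\<forall>x. \<bar>F x\<bar> \<le> pi / 2) \<and>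
    (\<forall>x. isCont F x \<longrightarrow> (\<lambda>n. ?F (r n) x) \<longlonglongrightarrow> F x))"
  proof (rule Helly_selection)
    show "continuous (at_right x) (?F n)" for n x by (intro continuous_intros Y_right)
    show "mono (?F n)" for n using Y_anti[of n] by (auto simp: mono_def antimono_def arctan_le_iff)
    show "\<bar>?F n x\<bar> \<le> pi / 2" for n x
      using arctan_bounded[of "- Y n x"] by (auto simp: abs_le_iff)
  qed
  then obtain r F where r: "strict_mono r" and F_right: "\<And>x. continuous (at_right x) F" and F_mono: "mono F"
    and F_lim: "\<And>x. isCont F x \<Longrightarrow> (\<lambda>n. ?F (r n) x) \<longlonglongrightarrow> F x" by blast
  have F_bound_cont: "\<bar>F t\<bar> < pi / 2" if t: "0 < t" "t < 1" "isCont F t" for t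
  proof -
    obtain C where C: "\<And>n. \<bar>Y n t\<bar> \<le> C" using Y_bound t by blast
    have "\<bar>?F n t\<bar> \<le> arctan C" for n
      using C[of n] by (auto simp: abs_le_iff arctan_le_iff arctan_minus[symmetric] simp del: arctan_minus)
    then have "\<bar>F t\<bar> \<le> arctan C"
      by (intro tendsto_upperbound[OF tendsto_rabs[OF F_lim[OF t(3)]]]) auto
    then show ?thesis using arctan_ubound[of C] by linarith
  qed
  have F_bound: "- (pi / 2) < F t" "F t < pi / 2" if t: "0 < t" "t < 1" for t
  proof -
    obtain c where c: "0 < c" "c < t" "isCont F c" using continuity_points_dense[OF F_mono t(1)] .
    obtain d where d: "t < d" "d < 1" "isCont F d" using continuity_points_dense[OF F_mono t(2)] .
    show "- (pi / 2) < F t" "F t < pi / 2"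
      using F_bound_cont[of c] F_bound_cont[of d] c d t monoD[OF F_mono, of c t] monoD[OF F_mono, of t d] by auto
  qed
  have cos_F: "cos (F t) \<noteq> 0" if "0 < t" "t < 1" for t
    using cos_gt_zero_pi[of "F t"] F_bound[OF that] by auto
  define X where "X t = - tan (F t)" for t
  have X_lim: "(\<lambda>n. Y (r n) t) \<longlonglongrightarrow> X t" if t: "0 < t" "t < 1" "isCont F t" for t
  proof -
    have "(\<lambda>n. - tan (?F (r n) t)) \<longlonglongrightarrow> X t"
      unfolding X_def by (intro tendsto_minus isCont_tendsto_compose[OF isCont_tan] F_lim cos_F t)
    then show ?thesis by (simp only: tan_arctan minus_minus)
  qed
  have X_anti: "antimono_on {0<..<1} X"
    unfolding monotone_on_def X_def
    by (auto intro!: tan_mono_le F_bound monoD[OF F_mono])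
  have X_meas: "X \<in> borel_measurable unit_measure"
    by (rule antimono_measurable_unit_measure[OF X_anti])
  have X_right: "continuous (at_right t) X" if "0 < t" "t < 1" for t
    unfolding X_def[abs_def] by (intro continuous_intros F_right cos_F that)
  have X_flat: "X t = 0" if t: "u1 < t" "t < u2" for t
  proof -
    have F0: "F c = 0" if "u1 < c" "c < u2" "isCont F c" for c
      using LIMSEQ_unique[OF F_lim[OF that(3)]] that by (simp add: Y_flat)
    obtain c where c: "u1 < c" "c < t" "isCont F c" using continuity_points_dense[OF F_mono t(1)] .
    obtain d where d: "t < d" "d < u2" "isCont F d" using continuity_points_dense[OF F_mono t(2)] .
    have "F t = 0"
      using F0[of c] F0[of d] c d t monoD[OF F_mono, of c t] monoD[OF F_mono, of t d] by auto
    then show ?thesis by (simp add: X_def)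
  qed
  have Y_meas: "Y n \<in> borel_measurable unit_measure" for n
    using Y_anti[of n] by (intro antimono_measurable_unit_measure) (auto simp: monotone_on_def)
  \<comment> \<open>Continuity points of \<open>F\<close> come first. The levels \<open>s\<close> at
    which convergence may fail are countable, so dominated convergence applies.\<close>
  have bal: "mean_tail X (X t) = 1/2 - p t" if t: "0 < t" "t < 1" "isCont F t" for t
  proof (rule LIMSEQ_unique)
    show "(\<lambda>n. mean_tail (Y (r n)) (Y (r n) t)) \<longlonglongrightarrow> mean_tail X (X t)"
      unfolding mean_tail_def
    proof (rule integral_dominated_convergence[where w = "\<lambda>_. 1"])
      show "(\<lambda>s. tail (X t - X s)) \<in> borel_measurable unit_measure"
        using X_meas by measurable
      show "(\<lambda>s. tail (Y (r n) t - Y (r n) s)) \<in> borel_measurable unit_measure" for n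
        using Y_meas[of "r n"] by measurable
      show "AE s in unit_measure. (\<lambda>n. tail (Y (r n) t - Y (r n) s)) \<longlonglongrightarrow> tail (X t - X s)"
        using AE_unit_measure_countable[OF mono_ctble_discont[OF F_mono]] AE_space
        by eventually_elim (auto intro!: isCont_tendsto_compose[OF tail_continuous] tendsto_intros X_lim t)
    qed (auto simp: tail_nonneg tail_le_1)
    obtain \<xi> where xi: "\<And>n. \<xi> n \<in> {0..1}" "\<And>n. mean_tail (Y n) (Y n t) = 1/2 - p (\<xi> n)"
        "\<And>n. \<bar>\<xi> n - t\<bar> \<le> 1 / real (Suc n) \<or> p (\<xi> n) = p t"
      using Y_bal[of t] t by (metis less_imp_le)
    \<comment> \<open>The points \<open>\<xi> n\<close> need not converge to \<open>t\<close>: on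
      the flat piece only the value of \<open>p\<close> is controlled.\<close>
    have "(\<lambda>n. p (\<xi> n)) \<longlonglongrightarrow> p t"
    proof (rule LIMSEQ_I)
      fix e :: real assume e: "0 < e"
      obtain d where d: "0 < d" "\<And>x. x \<in> {0..1} \<Longrightarrow> \<bar>x - t\<bar> < d \<Longrightarrow> \<bar>p x - p t\<bar> < e"
        using p_cont t e unfolding continuous_on_iff dist_real_def by (metis atLeastAtMost_iff less_imp_le)
      obtain n0 where n0: "1 / real (Suc n0) < d"
        using reals_Archimedean[OF d(1)] by (auto simp: inverse_eq_divide)
      show "\<exists>no. \<forall>n\<ge>no. norm (p (\<xi> n) - p t) < e"
      proof (intro exI allI impI)
        fix n assume "n0 \<le> n"
        then have "1 / real (Suc n) \<le> 1 / real (Suc n0)" by (intro divide_left_mono) auto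
        then show "norm (p (\<xi> n) - p t) < e"
          using xi(1,3)[of n] d(2)[of "\<xi> n"] n0 e by auto
      qed
    qed
    then have "(\<lambda>n. 1/2 - p (\<xi> (r n))) \<longlonglongrightarrow> 1/2 - p t"
      by (intro tendsto_intros LIMSEQ_subseq_LIMSEQ[OF _ r, unfolded comp_def])
    then show "(\<lambda>n. mean_tail (Y (r n)) (Y (r n) t)) \<longlonglongrightarrow> 1/2 - p t"
      by (simp add: xi(2))
  qed
  \<comment> \<open>At a discontinuity of \<open>F\<close> the equation is inherited from continuity
    points to the right, by right-continuity of \<open>X\<close>.\<close>
  have "mean_tail X (X t) = 1/2 - p t" if t: "0 < t" "t < 1" for t
  proof (rule ccontr)
    assume neq: "mean_tail X (X t) \<noteq> 1/2 - p t"
    have "(p \<longlongrightarrow> p t) (at_right t)"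
      by (rule p_tendsto_right) (use t in auto)
    moreover have "((\<lambda>s. mean_tail X (X s)) \<longlongrightarrow> mean_tail X (X t)) (at_right t)"
      using X_right[OF t] unfolding continuous_within
      by (rule isCont_tendsto_compose[OF mean_tail_continuous[OF X_meas]])
    ultimately have "((\<lambda>s. mean_tail X (X s) - (1/2 - p s)) \<longlongrightarrow> mean_tail X (X t) - (1/2 - p t)) (at_right t)"
      by (intro tendsto_intros)
    then have "\<forall>\<^sub>F s in at_right t. mean_tail X (X s) - (1/2 - p s) \<noteq> 0"
      using neq by (intro tendsto_imp_eventually_ne) auto
    then obtain b where b: "t < b" "\<And>s. t < s \<Longrightarrow> s < b \<Longrightarrow> mean_tail X (X s) - (1/2 - p s) \<noteq> 0"
      unfolding eventually_at_right_field by blast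
    obtain s where "t < s" "s < min b 1" "isCont F s"
      using continuity_points_dense[OF F_mono, of t "min b 1"] b t by auto
    then show False using b(2)[of s] bal[of s] t by auto
  qed
  then show ?thesis using that X_anti X_right X_flat by blast
qed

end

section \<open>Nonexistence\<close>

lemma pinning_bound_eq: "pinning_bound a = (1 - a + a\<^sup>2 - sqrt \<bar>1 - 2 * a\<bar>) / 3"
  by (auto simp: pinning_bound_def)

lemma pinning_bound_reflect: "pinning_bound (1 - a) = pinning_bound a"
  unfolding pinning_bound_eq by (simp add: power2_eq_square algebra_simps abs_minus_commute)

lemma AE_lborel_ex_in_interval:
  fixes a b :: real
  assumes "AE x in lborel. P x" "a < b"
  obtains x where "a < x" "x < b" "P x"
proof (rule ccontr)
  assume "\<not> thesis"
  then have "AE x in lborel. x \<notin> {a<..<b}"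
    using assms(1) that \<open>\<not> thesis\<close> by (auto elim!: eventually_mono)
  then have "emeasure lborel {a<..<b} = 0"
    by (subst (asm) AE_iff_measurable[of "{a<..<b}"]) auto
  then show False using assms(2) by simp
qed

lemma antimono_borel_measurable:
  fixes u :: "real \<Rightarrow> real"
  assumes "antimono u"
  shows "u \<in> borel_measurable borel"
proof -
  have "mono (\<lambda>x. - u x)" using assms by (simp add: mono_def antimono_def)
  from borel_measurable_uminus[OF borel_measurable_mono[OF this]] show ?thesis by simp
qed

text \<open>An increasing function with limit 1 at minus infinity is at least 1 everywhere, against
  the limit 0 at plus infinity.\<close>

lemma stationary_interface_antimono:
  assumes "stationary_interface K f d u"
  shows "antimono u"
proof (rule ccontr)
  assume "\<not> antimono u"
  then have m: "mono u" and l: "(u \<longlongrightarrow> 1) at_bot" "(u \<longlongrightarrow> 0) at_top"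
    using assms by (auto simp: stationary_interface_def)
  have "1 \<le> u x" for x
  proof (rule tendsto_upperbound[OF l(1)])
    show "\<forall>\<^sub>F y in at_bot. u y \<le> u x"
      using eventually_le_at_bot[of x] by eventually_elim (rule monoD[OF m])
  qed simp
  then have "1 \<le> (0 :: real)"
    by (intro tendsto_lowerbound[OF l(2)]) auto
  then show False by simp
qed

section \<open>The cubic \<open>d * v - cubic a v\<close>, its primitive and its running
  maximum\<close>

definition reaction_balance :: "real \<Rightarrow> real \<Rightarrow> real \<Rightarrow> real" where
  "reaction_balance a d v = d * v - cubic a v"

definition reaction_balance_primitive :: "real \<Rightarrow> real \<Rightarrow> real \<Rightarrow> real" where
  "reaction_balance_primitive a d v = v ^ 4 / 4 - (1 + a) * v ^ 3 / 3 + (a + d) * v\<^sup>2 / 2"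

lemma reaction_balance_eq: "reaction_balance a d v = v ^ 3 - (1 + a) * v\<^sup>2 + (a + d) * v"
  by (simp add: reaction_balance_def cubic_def algebra_simps power2_eq_square power3_eq_cube)

lemma reaction_balance_primitive_deriv:
  "(reaction_balance_primitive a d has_real_derivative reaction_balance a d v) (at v within S)"
  unfolding reaction_balance_primitive_def[abs_def] reaction_balance_eq
  by (auto intro!: derivative_eq_intros)

lemma continuous_on_reaction_balance [continuous_intros]:
  "continuous_on S f \<Longrightarrow> continuous_on S (\<lambda>x. reaction_balance a d (f x))"
  unfolding reaction_balance_eq by (intro continuous_intros)

lemma reaction_balance_has_integral:
  "s \<le> t \<Longrightarrow> (reaction_balance a d has_integral
    reaction_balance_primitive a d t - reaction_balance_primitive a d s) {s..t}"
  by (rule fundamental_theorem_of_calculus)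
    (auto simp flip: has_real_derivative_iff_has_vector_derivative intro: reaction_balance_primitive_deriv)

text \<open>With \<open>l = sqrt (1 - a + a\<^sup>2 - 3 * d) / 3\<close>, the local maximum of the cubic \<open>reaction_balance a d\<close> is at
  \<open>(1 + a) / 3 - l\<close>, and it attains that value again at \<open>(1 + a) / 3 + 2 * l\<close>.\<close>

lemma reaction_balance_running_max:
  fixes a d l :: real
  assumes l: "9 * l\<^sup>2 = 1 - a + a\<^sup>2 - 3 * d" "0 \<le> l" and v: "v \<le> t"
  defines "p \<equiv> (1 + a) / 3 - l" and "q \<equiv> (1 + a) / 3 + 2 * l"
  shows "reaction_balance a d v \<le> reaction_balance a d t + (t - p)\<^sup>2 * (q - t) * indicator {p..q} t"
proof -
  define h where "h = reaction_balance a d p"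
  have pq: "p \<le> q" using l by (simp add: p_def q_def)
  have d: "d = (1 - a + a\<^sup>2 - 9 * l\<^sup>2) / 3" using l(1) by simp
  have fact: "reaction_balance a d x = h + (x - p)\<^sup>2 * (x - q)" for x
    unfolding h_def reaction_balance_eq p_def q_def d by (simp add: field_simps power2_eq_square power3_eq_cube)
  have nonpos: "(v - p)\<^sup>2 * (v - q) \<le> 0" if "v \<le> q"
    using that by (simp add: mult_nonneg_nonpos)
  \<comment> \<open>Left of \<open>p\<close> and right of \<open>q\<close> the cubic is its own
    running maximum; in between the right-hand side equals \<open>h\<close>.\<close>
  consider "t < p" | "p \<le> t" "t \<le> q" | "q < t" by linarith
  then show ?thesis
  proof cases
    case 1
    have "(p - t)\<^sup>2 * (q - t) \<le> (p - v)\<^sup>2 * (q - v)"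
      using 1 v pq by (intro mult_mono power_mono) auto
    then show ?thesis using 1 unfolding fact by (simp add: algebra_simps power2_commute)
  next
    case 2
    then show ?thesis unfolding fact using nonpos v by (simp add: algebra_simps)
  next
    case 3
    have "(v - p)\<^sup>2 * (v - q) \<le> (t - p)\<^sup>2 * (t - q)"
    proof (cases "v \<le> q")
      case True
      have "0 \<le> (t - p)\<^sup>2 * (t - q)" using 3 by simp
      then show ?thesis using nonpos[OF True] by linarith
    next
      case False
      then show ?thesis using v pq by (intro mult_mono power_mono) auto
    qed
    then show ?thesis unfolding fact using 3 by simp
  qed
qed

text \<open>Twelve times the difference quotient is a sum of two squares and of
  \<open>- 4 * (1 - a + a\<^sup>2 - 3 * d)\<close>.\<close>

lemma reaction_balance_mono:
  fixes a d :: real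
  assumes "1 - a + a\<^sup>2 - 3 * d \<le> 0" and "v \<le> t"
  shows "reaction_balance a d v \<le> reaction_balance a d t"
proof -
  have "0 \<le> 3 * (t - v)\<^sup>2 + (3 * (t + v) - 2 * (1 + a))\<^sup>2 + 4 * (3 * d - 1 + a - a\<^sup>2)"
    using assms(1) by (intro add_nonneg_nonneg) auto
  also have "\<dots> = 12 * (t\<^sup>2 + t * v + v\<^sup>2 - (1 + a) * (t + v) + a + d)"
    by (simp add: algebra_simps power2_eq_square)
  finally have "0 \<le> t\<^sup>2 + t * v + v\<^sup>2 - (1 + a) * (t + v) + a + d" by simp
  then have "0 \<le> (t - v) * (t\<^sup>2 + t * v + v\<^sup>2 - (1 + a) * (t + v) + a + d)"
    using assms(2) by simp
  also have "\<dots> = reaction_balance a d t - reaction_balance a d v"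
    unfolding reaction_balance_eq by (simp add: algebra_simps power2_eq_square power3_eq_cube)
  finally show ?thesis by simp
qed

section \<open>Reflection symmetry and the upper bound on the coupling strength\<close>

context kernel
begin

lemma convolution_reflect:
  assumes "u \<in> borel_measurable borel" "\<And>x. u x \<in> {0..1}"
  shows "convolution K (\<lambda>x. 1 - u (- x)) x = 1 - convolution K u (- x)"
proof -
  have Kx: "integrable lborel (\<lambda>y. K (x - y))" for x
    using lborel_integrable_real_affine[OF K_integrable, of "-1" x] by simp
  have "integrable lborel (\<lambda>y. K (x - y) * u (- y))"
    by (rule Bochner_Integration.integrable_bound[OF Kx[of x]])
      (use assms borel_measurable_integrable[OF Kx[of x]] in \<open>auto simp: abs_mult K_nonneg intro!: mult_left_le\<close>)
  then have "convolution K (\<lambda>x. 1 - u (- x)) x = (LINT y|lborel. K (x - y)) - (LINT y|lborel. K (x - y) * u (- y))"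
    unfolding convolution_def by (simp add: right_diff_distrib Kx)
  also have "(LINT y|lborel. K (x - y)) = 1"
    using LINT_reflect[of K x] K_mass by simp
  also have "(LINT y|lborel. K (x - y) * u (- y)) = convolution K u (- x)"
    unfolding convolution_def
    by (subst LINT_reflect[symmetric, of _ 0])
      (use K_even in \<open>auto intro!: Bochner_Integration.integral_cong simp: K_even[symmetric, of "x + _"]\<close>)
  finally show ?thesis .
qed

text \<open>This rests on \<open>cubic (1 - a) (1 - v) = - cubic a v\<close> and reduces
  \<open>a > 1/2\<close> to \<open>a < 1/2\<close>.\<close>

lemma stationary_interface_reflect:
  assumes "stationary_interface K (cubic a) d u"
  shows "stationary_interface K (cubic (1 - a)) d (\<lambda>x. 1 - u (- x))"
proof -
  have anti: "antimono u" by (rule stationary_interface_antimono[OF assms])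
  have u: "\<And>x. u x \<in> {0..1}" "(u \<longlongrightarrow> 1) at_bot" "(u \<longlongrightarrow> 0) at_top"
    "AE x in lborel. 0 = d * (- u x + convolution K u x) + cubic a (u x)"
    using assms by (auto simp: stationary_interface_def)
  have "AE x in distr lborel borel uminus. 0 = d * (- u x + convolution K u x) + cubic a (u x)"
    unfolding lborel_distr_uminus by (rule u(4))
  then have "AE x in lborel. 0 = d * (- u (- x) + convolution K u (- x)) + cubic a (u (- x))"
    by (rule AE_distrD[rotated]) simp
  then have "AE x in lborel. 0 = d * (- (1 - u (- x)) + convolution K (\<lambda>x. 1 - u (- x)) x) + cubic (1 - a) (1 - u (- x))"
    by (auto elim!: eventually_mono
        simp: convolution_reflect[OF antimono_borel_measurable[OF anti] u(1)] cubic_def algebra_simps)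
  moreover have "((\<lambda>x. 1 - u (- x)) \<longlongrightarrow> 1 - 0) at_bot"
    by (intro tendsto_intros filterlim_compose[OF u(3)] filterlim_uminus_at_top_at_bot)
  moreover have "((\<lambda>x. 1 - u (- x)) \<longlongrightarrow> 1 - 1) at_top"
    by (intro tendsto_intros filterlim_compose[OF u(2)] filterlim_uminus_at_bot_at_top)
  moreover have "antimono (\<lambda>x. 1 - u (- x))"
    using anti by (auto simp: antimono_def)
  ultimately show ?thesis
    unfolding stationary_interface_def using u(1) by simp
qed

text \<open>Just to the right of \<open>X t\<close> the values of \<open>u\<close> are at most
  \<open>t\<close>, and at almost every such point the equation identifies
  \<open>d * mean_tail X x\<close> with \<open>reaction_balance a d (u x)\<close>. Continuity of
  \<open>mean_tail X\<close> carries the bound to \<open>X t\<close>.\<close>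

lemma stationary_interface_quantile:
  assumes st: "stationary_interface K (cubic a) d u"
  obtains X where "X \<in> borel_measurable unit_measure"
    and "\<And>t M. 0 < t \<Longrightarrow> t < 1 \<Longrightarrow> (\<And>v. 0 \<le> v \<Longrightarrow> v \<le> t \<Longrightarrow> reaction_balance a d v \<le> M) \<Longrightarrow> d * mean_tail X (X t) \<le> M"
proof -
  have anti: "antimono u" by (rule stationary_interface_antimono[OF st])
  have u: "\<And>x. u x \<in> {0..1}" "(u \<longlongrightarrow> 1) at_bot" "(u \<longlongrightarrow> 0) at_top"
    "AE x in lborel. 0 = d * (- u x + convolution K u x) + cubic a (u x)"
    using st by (auto simp: stationary_interface_def)
  define X where "X t = Sup {x. t < u x}" for t
  have ne: "{x. t < u x} \<noteq> {}" if "t < 1" for t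
    using order_tendstoD(1)[OF u(2) that] by (auto simp: eventually_at_bot_linorder)
  have bdd: "bdd_above {x. t < u x}" if t: "0 < t" for t
  proof -
    obtain N where "\<And>x. N \<le> x \<Longrightarrow> u x < t"
      using order_tendstoD(2)[OF u(3) t] by (auto simp: eventually_at_top_linorder)
    then have "x \<le> N" if "t < u x" for x using that by (meson less_asym linear)
    then show ?thesis by (intro bdd_aboveI[of _ N]) auto
  qed
  have X_anti: "antimono_on {0<..<1} X"
    unfolding monotone_on_def X_def by (auto intro!: cSup_subset_mono ne bdd)
  have X_meas: "X \<in> borel_measurable unit_measure"
    by (rule antimono_measurable_unit_measure[OF X_anti])
  have below: "s < u y" if "0 < s" "s < 1" "y < X s" for s y
    using that less_cSupE[of y "{x. s < u x}"] ne[of s] antimonoD[OF anti]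
    unfolding X_def by (metis less_imp_le mem_Collect_eq order_less_le_trans)
  have above: "u y \<le> s" if "0 < s" "s < 1" "X s < y" for s y
    using that cSup_upper[OF _ bdd[of s], of y] unfolding X_def by force
  have conv: "convolution K u x = mean_tail X x" for x
    by (rule convolution_eq_mean_tail[OF X_meas antimono_borel_measurable[OF anti] u(1) below above])
  show ?thesis
  proof
    show "d * mean_tail X (X t) \<le> M" if t: "0 < t" "t < 1"
      and M: "\<And>v. 0 \<le> v \<Longrightarrow> v \<le> t \<Longrightarrow> reaction_balance a d v \<le> M" for t M
    proof (rule ccontr)
      assume "\<not> ?thesis"
      then have "M < d * mean_tail X (X t)" by simp
      moreover have "((\<lambda>x. d * mean_tail X x) \<longlongrightarrow> d * mean_tail X (X t)) (at_right (X t))"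
        by (intro tendsto_intros isCont_tendsto_compose[OF mean_tail_continuous[OF X_meas]])
      ultimately have "\<forall>\<^sub>F x in at_right (X t). M < d * mean_tail X x"
        by (metis order_tendstoD(1))
      then obtain b where b: "X t < b" "\<And>x. X t < x \<Longrightarrow> x < b \<Longrightarrow> M < d * mean_tail X x"
        unfolding eventually_at_right_field by blast
      obtain x where x: "X t < x" "x < b" "0 = d * (- u x + convolution K u x) + cubic a (u x)"
        using AE_lborel_ex_in_interval[OF u(4) b(1)] .
      then have "d * mean_tail X x = reaction_balance a d (u x)"
        by (simp add: conv reaction_balance_def algebra_simps)
      also have "\<dots> \<le> M" using u(1)[of x] above[OF t x(1)] by (intro M) auto
      finally show False using b(2)[OF x(1,2)] by simp
    qed
  qed (rule X_meas)
qed

text \<open>Integrating the running-maximum bound over all levels gives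
  \<open>d / 2 \<le> d / 2 - (1 - 2 * a) / 12 + L\<^sup>2 / 12\<close>, where the left side comes
  from \<open>mean_mean_tail\<close>. This is \<open>1 - 2 * a \<le> L\<^sup>2\<close>.\<close>

lemma stationary_interface_bound_left:
  assumes st: "stationary_interface K (cubic a) d u" and a: "a < 1/2"
  shows "d \<le> pinning_bound a"
proof -
  obtain X where X: "X \<in> borel_measurable unit_measure"
    and bound: "\<And>t M. 0 < t \<Longrightarrow> t < 1 \<Longrightarrow> (\<And>v. 0 \<le> v \<Longrightarrow> v \<le> t \<Longrightarrow> reaction_balance a d v \<le> M) \<Longrightarrow> d * mean_tail X (X t) \<le> M"
    using stationary_interface_quantile[OF st] by blast
  have int: "integrable unit_measure (\<lambda>t. d * mean_tail X (X t))"
    by (intro integrable_mult_right unit_measure.integrable_const_bound[where B = 1])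
      (use X in \<open>auto simp: mean_tail_bounds measurable_compose[OF X mean_tail_measurable[OF X]]\<close>)
  have half: "(LINT t|unit_measure. d * mean_tail X (X t)) = d / 2"
    using mean_mean_tail[OF X] by simp
  have G: "integrable unit_measure (reaction_balance a d)"
    "(LINT t|unit_measure. reaction_balance a d t) = d / 2 - (1 - 2 * a) / 12"
  proof -
    have c: "continuous_on {0..1} (reaction_balance a d)"
      using continuous_on_reaction_balance[OF continuous_on_id] by simp
    show "integrable unit_measure (reaction_balance a d)"
      by (rule integral_unit_measure[OF c])
    show "(LINT t|unit_measure. reaction_balance a d t) = d / 2 - (1 - 2 * a) / 12"
      unfolding integral_unit_measure(2)[OF c]
      using integral_unique[OF reaction_balance_has_integral[of 0 1 a d]]
      by (simp add: reaction_balance_primitive_def field_simps)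
  qed
  define L where "L = 1 - a + a\<^sup>2 - 3 * d"
  \<comment> \<open>Otherwise \<open>reaction_balance\<close> is increasing and its own running
    maximum, but its mean is below \<open>d / 2\<close>. The sign is used when the square root is
    taken at the end.\<close>
  have "0 < L"
  proof (rule ccontr)
    assume "\<not> 0 < L"
    then have "(LINT t|unit_measure. d * mean_tail X (X t)) \<le> (LINT t|unit_measure. reaction_balance a d t)"
      by (intro integral_mono int G(1) bound) (auto simp: L_def intro: reaction_balance_mono)
    then show False unfolding half G(2) using a by simp
  qed
  define l where "l = sqrt L / 3"
  have l: "9 * l\<^sup>2 = L" "0 \<le> l" using \<open>0 < L\<close> by (auto simp: l_def power_divide)
  define p q where "p = (1 + a) / 3 - l" and "q = (1 + a) / 3 + 2 * l"
  let ?r = "\<lambda>t. (t - p)\<^sup>2 * (q - t) * indicator {p..q} t"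
  have r: "has_bochner_integral lborel ?r
    (((q - p) * (q - p) ^ 3 / 3 - (q - p) ^ 4 / 4) - ((q - p) * (p - p) ^ 3 / 3 - (p - p) ^ 4 / 4))"
  proof (rule has_bochner_integral_FTC_Icc_real)
    fix t
    have "((\<lambda>t. (q - p) * (t - p) ^ 3 / 3 - (t - p) ^ 4 / 4) has_real_derivative
      (q - p) * (3 * (t - p)\<^sup>2) / 3 - 4 * (t - p) ^ 3 / 4) (at t)"
      by (auto intro!: derivative_eq_intros)
    also have "(q - p) * (3 * (t - p)\<^sup>2) / 3 - 4 * (t - p) ^ 3 / 4 = (t - p)\<^sup>2 * (q - t)"
      by (simp add: field_simps power2_eq_square power3_eq_cube)
    finally show "((\<lambda>t. (q - p) * (t - p) ^ 3 / 3 - (t - p) ^ 4 / 4) has_real_derivative (t - p)\<^sup>2 * (q - t)) (at t)" .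
  qed (use l(2) in \<open>auto simp: p_def q_def intro!: continuous_intros\<close>)
  have rnn: "0 \<le> ?r t" for t by (auto simp: indicator_def)
  have ri: "integrable unit_measure ?r"
    using integrable_real_mult_indicator[of "{0<..<1}" lborel ?r] r
    by (simp add: unit_measure_def integrable_restrict_space has_bochner_integral_iff mult_ac)
  \<comment> \<open>The interval \<open>{p..q}\<close> may leave the unit interval; since
    \<open>?r\<close> is nonnegative, integrating over the line gives an upper bound.\<close>
  have "(LINT t|unit_measure. ?r t) \<le> (LINT t|lborel. ?r t)"
    unfolding unit_measure_def
    by (subst integral_restrict_space, simp, rule integral_mono_AE')
      (use r rnn in \<open>auto simp: has_bochner_integral_iff indicator_def\<close>)
  also have "\<dots> = L\<^sup>2 / 12"
  proof -
    have "q - p = 3 * l" by (simp add: p_def q_def)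
    then have "(LINT t|lborel. ?r t) = (3 * l) ^ 4 / 12"
      using r by (simp add: has_bochner_integral_iff power_eq_if)
    also have "(3 * l) ^ 4 = (9 * l\<^sup>2)\<^sup>2" by (simp add: power_mult_distrib)
    finally show ?thesis using l(1) by simp
  qed
  finally have ru: "(LINT t|unit_measure. ?r t) \<le> L\<^sup>2 / 12" .
  have "(LINT t|unit_measure. d * mean_tail X (X t)) \<le> (LINT t|unit_measure. reaction_balance a d t + ?r t)"
  proof (rule integral_mono[OF int])
    fix t assume "t \<in> space unit_measure"
    then have t: "0 < t" "t < 1" by auto
    show "d * mean_tail X (X t) \<le> reaction_balance a d t + ?r t"
      unfolding p_def q_def
      by (rule bound[OF t], rule reaction_balance_running_max) (use l in \<open>auto simp: L_def\<close>)
  qed (rule Bochner_Integration.integrable_add[OF G(1) ri])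
  then have "1 - 2 * a \<le> L\<^sup>2"
    unfolding half Bochner_Integration.integral_add[OF G(1) ri] G(2) using ru by simp
  then have "sqrt (1 - 2 * a) \<le> L"
    using \<open>0 < L\<close> by (intro real_le_lsqrt) auto
  then show ?thesis using a by (simp add: pinning_bound_eq L_def)
qed

lemma stationary_interface_bound:
  assumes st: "stationary_interface K (cubic a) d u" and a: "a \<noteq> 1/2"
  shows "d \<le> pinning_bound a"
proof (cases "a < 1/2")
  case False
  then have "d \<le> pinning_bound (1 - a)"
    using stationary_interface_bound_left[OF stationary_interface_reflect[OF st]] a by auto
  then show ?thesis by (simp only: pinning_bound_reflect)
qed (rule stationary_interface_bound_left[OF st])

end

section \<open>Existence\<close>

text \<open>The front \<open>v\<close> is the generalised inverse of \<open>X\<close>.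
  Right-continuity of \<open>X\<close> makes \<open>s < v x\<close> strict whenever
  \<open>x < X s\<close>, and a value of \<open>v\<close> strictly between \<open>u1\<close> and
  \<open>u2\<close> would force \<open>X\<close> to vary there.\<close>

theorem (in flat_profile) profile_interface:
  assumes p0: "p 0 = 1/2" and p1: "p 1 = - 1/2"
  obtains v where "antimono v" "\<And>x. v x \<in> {0..1}" "(v \<longlongrightarrow> 1) at_bot" "(v \<longlongrightarrow> 0) at_top"
    and "\<And>x. v x \<le> u1 \<or> u2 \<le> v x" and "\<And>x. convolution K v x = 1/2 - p (v x)"
proof -
  obtain X where X_anti: "antimono_on {0<..<1} X"
    and X_right: "\<And>t. 0 < t \<Longrightarrow> t < 1 \<Longrightarrow> continuous (at_right t) X"
    and X_flat: "\<And>t. u1 < t \<Longrightarrow> t < u2 \<Longrightarrow> X t = 0"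
    and bal: "\<And>t. 0 < t \<Longrightarrow> t < 1 \<Longrightarrow> mean_tail X (X t) = 1/2 - p t"
    using quantile_exists by blast
  have X_meas: "X \<in> borel_measurable unit_measure"
    by (rule antimono_measurable_unit_measure[OF X_anti])
  \<comment> \<open>The element 0 keeps the set nonempty when \<open>x\<close> lies beyond all
    \<open>X s\<close>.\<close>
  define S where "S x = insert 0 {s. 0 < s \<and> s < 1 \<and> x < X s}" for x
  define v where "v x = Sup (S x)" for x
  have bdd: "bdd_above (S x)" for x
    by (rule bdd_aboveI[of _ 1]) (auto simp: S_def)
  have ne: "S x \<noteq> {}" for x by (auto simp: S_def)
  have v01: "v x \<in> {0..1}" for x
  proof -
    have "0 \<le> Sup (S x)" by (rule cSup_upper[OF _ bdd]) (simp add: S_def)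
    moreover have "Sup (S x) \<le> 1" by (rule cSup_least[OF ne]) (auto simp: S_def)
    ultimately show ?thesis by (simp add: v_def)
  qed
  have below: "s < v x" if s: "0 < s" "s < 1" and x: "x < X s" for s x
  proof -
    have "(X \<longlongrightarrow> X s) (at_right s)" using X_right[OF s] by (simp add: continuous_within)
    then have "\<forall>\<^sub>F r in at_right s. x < X r" using x by (rule order_tendstoD(1))
    then obtain b where b: "s < b" "\<And>r. s < r \<Longrightarrow> r < b \<Longrightarrow> x < X r"
      unfolding eventually_at_right_field by blast
    obtain r where r: "s < r" "r < min b 1" using dense[of s "min b 1"] b s by auto
    then have "r \<in> S x" using b(2)[of r] s by (auto simp: S_def)
    then have "r \<le> v x" unfolding v_def by (rule cSup_upper[OF _ bdd])
    then show ?thesis using r by simp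
  qed
  have above: "v x \<le> s" if s: "0 < s" "s < 1" and x: "X s \<le> x" for s x
    unfolding v_def
  proof (rule cSup_least[OF ne])
    fix r assume "r \<in> S x"
    then show "r \<le> s"
      using s x monotone_onD[OF X_anti, of s r] by (force simp: S_def not_le[symmetric] intro: ccontr)
  qed
  have v_anti: "antimono v"
    unfolding v_def by (intro antimonoI cSup_subset_mono ne bdd) (auto simp: S_def)
  have conv: "convolution K v x = mean_tail X x" for x
    by (rule convolution_eq_mean_tail[OF X_meas antimono_borel_measurable[OF v_anti] v01 below above]) auto
  show ?thesis
  proof
    show "(v \<longlongrightarrow> 1) at_bot"
    proof (rule order_tendstoI)
      fix e :: real assume "e < 1"
      then obtain s where s: "max e 0 < s" "s < 1" using dense[of "max e 0" 1] by auto
      show "\<forall>\<^sub>F x in at_bot. e < v x"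
        using eventually_gt_at_bot[of "X s"] by eventually_elim (use below[of s] s in \<open>auto intro: less_trans\<close>)
    next
      fix e :: real assume "1 < e"
      then show "\<forall>\<^sub>F x in at_bot. v x < e"
        using v01 by (intro always_eventually allI) (meson atLeastAtMost_iff le_less_trans)
    qed
    show "(v \<longlongrightarrow> 0) at_top"
    proof (rule order_tendstoI)
      fix e :: real assume "0 < e"
      then obtain s where s: "0 < s" "s < min e 1" using dense[of 0 "min e 1"] by auto
      show "\<forall>\<^sub>F x in at_top. v x < e"
        using eventually_ge_at_top[of "X s"] by eventually_elim (use above[of s] s in \<open>auto intro: le_less_trans\<close>)
    next
      fix e :: real assume "e < 0"
      then show "\<forall>\<^sub>F x in at_top. e < v x"
        using v01 by (intro always_eventually allI) (meson atLeastAtMost_iff less_le_trans)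
    qed
    show "v x \<le> u1 \<or> u2 \<le> v x" for x
    proof (rule ccontr)
      assume "\<not> ?thesis"
      then have "u1 < v x" "v x < u2" by auto
      then obtain s r where "u1 < s" "s < v x" "v x < r" "r < u2" using dense by metis
      then have "x < X s" "X r \<le> x" using above[of s x] below[of r x] u by (auto simp: not_le[symmetric])
      then show False using X_flat[of s] X_flat[of r] \<open>u1 < s\<close> \<open>s < v x\<close> \<open>v x < r\<close> \<open>r < u2\<close> by auto
    qed
    show "convolution K v x = 1/2 - p (v x)" for x
    proof -
      \<comment> \<open>The two inequalities come from the levels just above and just below
        \<open>v x\<close>. Where there are none, at 1 and at 0, \<open>p1\<close> and
        \<open>p0\<close> take over.\<close>
      have "mean_tail X x \<le> 1/2 - p (v x)"
      proof (cases "v x = 1")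
        case True
        then show ?thesis using mean_tail_bounds(2)[OF X_meas, of x] p1 by simp
      next
        case False
        then have lt: "0 \<le> v x" "v x < 1" using v01[of x] by auto
        have "\<forall>\<^sub>F s in at_right (v x). mean_tail X x \<le> 1/2 - p s"
          unfolding eventually_at_right[OF lt(2)]
        proof (intro exI[of _ 1] conjI allI impI lt)
          fix s assume s: "v x < s" "s < 1"
          then have "X s \<le> x" using below[of s x] lt by (auto simp: not_le[symmetric])
          then show "mean_tail X x \<le> 1/2 - p s"
            using mean_tail_antimono[OF X_meas, of "X s" x] bal[of s] s lt by simp
        qed
        then show ?thesis
          by (rule tendsto_lowerbound[OF tendsto_diff[OF tendsto_const p_tendsto_right[OF lt]]]) simp
      qed
      moreover have "1/2 - p (v x) \<le> mean_tail X x"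
      proof (cases "v x = 0")
        case True
        then show ?thesis using mean_tail_bounds(1)[OF X_meas, of x] p0 by simp
      next
        case False
        then have lt: "0 < v x" "v x \<le> 1" using v01[of x] by auto
        have "\<forall>\<^sub>F s in at_left (v x). 1/2 - p s \<le> mean_tail X x"
          unfolding eventually_at_left[OF lt(1)]
        proof (intro exI[of _ 0] conjI allI impI lt)
          fix s assume s: "0 < s" "s < v x"
          then have "x \<le> X s" using above[of s x] lt by (cases "x \<le> X s") auto
          then show "1/2 - p s \<le> mean_tail X x"
            using mean_tail_antimono[OF X_meas, of x "X s"] bal[of s] s lt by simp
        qed
        then show ?thesis
          by (rule tendsto_upperbound[OF tendsto_diff[OF tendsto_const p_tendsto_left[OF lt]]]) simp
      qed
      ultimately show ?thesis by (simp add: conv)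
    qed
  qed (use v_anti v01 in auto)
qed

text \<open>Here \<open>u1 = 1/2 - \<sigma> + s - D\<close> and \<open>u2 = 1/2 - \<sigma> + s + D\<close> are the levels at which the interface jumps, and
  \<open>1/2 - 3 * \<sigma> = a\<close>. For \<open>d = 0\<close> they are \<open>0\<close> and \<open>1\<close>, with \<open>D = 1/2\<close> and \<open>s = \<sigma>\<close>;
  the lemma says that they move inwards as \<open>d\<close> grows.\<close>

lemma jump_levels_move_inwards:
  fixes s D \<sigma> :: real
  assumes area: "s * D ^ 3 = \<sigma> / 8" and dist: "D\<^sup>2 + 3 * s\<^sup>2 < 1/4 + 3 * \<sigma>\<^sup>2"
    and pos: "0 \<le> s" "0 < D" "0 \<le> \<sigma>" and steep: "3 * s < D" "\<sigma> < 1/6"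
  shows "D < 1/2" "\<sigma> \<le> s" "s + D < \<sigma> + 1/2"
proof -
  show D: "D < 1/2"
  proof (rule ccontr)
    assume "\<not> D < 1/2"
    then have D: "1/2 \<le> D" by simp
    \<comment> \<open>For \<open>D \<ge> 1/2\<close> the area relation forces \<open>s\<close> close
      to \<sigma>, so close that
      \<open>3 * (\<sigma>\<^sup>2 - s\<^sup>2) \<le> D\<^sup>2 - 1/4\<close>, against
      \<open>dist\<close>. The bound \<open>\<sigma> < 1/6\<close> is what turns the constant 18
      into the factor 1.\<close>
    have "(\<sigma> - s) * D ^ 3 = \<sigma> * (D ^ 3 - 1/8)" using area by (simp add: algebra_simps)
    also have "\<dots> = \<sigma> * ((D - 1/2) * (D\<^sup>2 + D / 2 + 1/4))" by (simp add: field_simps power2_eq_square power3_eq_cube)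
    also have "\<dots> \<le> \<sigma> * ((D - 1/2) * (3 * D\<^sup>2))"
    proof -
      have "(1/2)\<^sup>2 \<le> D\<^sup>2" "1/2 * D \<le> D * D" using D by (auto intro: power_mono)
      then have "D\<^sup>2 + D / 2 + 1/4 \<le> 3 * D\<^sup>2" by (simp add: power2_eq_square)
      then show ?thesis using D pos by (intro mult_left_mono) auto
    qed
    also have "\<dots> = (3 * \<sigma> * (D - 1/2) / D) * D ^ 3" using pos by (simp add: power2_eq_square power3_eq_cube)
    finally have 1: "\<sigma> - s \<le> 3 * \<sigma> * (D - 1/2) / D"
      by (rule mult_right_le_imp_le) (use pos in simp)
    have "\<sigma> * (1/2) ^ 3 \<le> \<sigma> * D ^ 3" using D pos by (intro mult_left_mono power_mono) auto
    then have "s * D ^ 3 \<le> \<sigma> * D ^ 3" using area by (simp add: power3_eq_cube)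
    then have ss: "s \<le> \<sigma>" using pos by simp
    have "3 * (\<sigma>\<^sup>2 - s\<^sup>2) = 3 * (\<sigma> + s) * (\<sigma> - s)" by (simp add: algebra_simps power2_eq_square)
    also have "\<dots> \<le> 3 * (2 * \<sigma>) * (\<sigma> - s)" using ss pos by (intro mult_right_mono) auto
    also have "\<dots> \<le> 3 * (2 * \<sigma>) * (3 * \<sigma> * (D - 1/2) / D)" using 1 pos by (intro mult_left_mono) auto
    also have "\<dots> = 18 * \<sigma>\<^sup>2 * ((D - 1/2) / D)" by (simp add: power2_eq_square)
    also have "\<dots> \<le> 18 * (1/6)\<^sup>2 * ((D - 1/2) / (1/2))"
      using D pos steep by (intro mult_mono power_mono divide_left_mono) auto
    also have "\<dots> = D - 1/2" by (simp add: power2_eq_square)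
    also have "\<dots> \<le> (D - 1/2) * (D + 1/2)" using D by (simp add: mult_le_cancel_left1)
    also have "\<dots> = D\<^sup>2 - 1/4" by (simp add: algebra_simps power2_eq_square)
    finally show False using dist by simp
  qed
  have D3: "D ^ 3 < 1/8" using power_strict_mono[OF D, of 3] pos by (simp add: power3_eq_cube)
  have "s * D ^ 3 \<le> s * (1/8)" using D3 pos by (intro mult_left_mono) auto
  then show "\<sigma> \<le> s" using area by simp
  have "s - \<sigma> = 8 * s * (1/8 - D ^ 3)" using area by (simp add: algebra_simps)
  also have "\<dots> = 8 * s * ((1/2 - D) * (D\<^sup>2 + D / 2 + 1/4))"
    by (simp add: field_simps power2_eq_square power3_eq_cube)
  also have "\<dots> < 1/2 - D"
  proof -
    \<comment> \<open>Here \<open>3 * s < D < 1/2\<close>, and the quadratic factor is below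
      \<open>3 / 4\<close>, its value at \<open>D = 1/2\<close>.\<close>
    have "8 * s \<le> 4 / 3" using steep D by simp
    then have "8 * s * (D\<^sup>2 + D / 2 + 1/4) \<le> 4 / 3 * (D\<^sup>2 + D / 2 + 1/4)"
      by (rule mult_right_mono) (use pos in simp)
    also have "\<dots> < 1"
      using D pos power_strict_mono[OF D, of 2] by (simp add: power2_eq_square)
    finally have "8 * s * (D\<^sup>2 + D / 2 + 1/4) < 1" .
    then have "8 * s * (D\<^sup>2 + D / 2 + 1/4) * (1/2 - D) < 1 * (1/2 - D)"
      using D by (intro mult_strict_right_mono) auto
    then show ?thesis by (simp add: mult_ac)
  qed
  finally show "s + D < \<sigma> + 1/2" by simp
qed

text \<open>Intermediate value theorem in \<open>s\<close>, from 0 to \<open>sqrt L / 6\<close>. At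
  the upper end \<open>D = 3 * s\<close> and \<open>48 * (s * D ^ 3) = L\<^sup>2\<close>, so
  \<open>b < L\<^sup>2\<close> keeps the solution away from it.\<close>

lemma jump_parameters_exist:
  fixes L :: real
  assumes "0 \<le> b" "b < L\<^sup>2" "0 < L"
  obtains s D where "0 \<le> s" "3 * s < D" "D\<^sup>2 = L / 3 - 3 * s\<^sup>2" "48 * (s * D ^ 3) = b"
proof -
  define l where "l = sqrt L"
  have l: "0 < l" "l\<^sup>2 = L" using assms by (auto simp: l_def)
  let ?D = "\<lambda>s. sqrt (L / 3 - 3 * s\<^sup>2)"
  let ?k = "\<lambda>s. 48 * (s * ?D s ^ 3)"
  have end_D: "?D (l / 6) = l / 2"
  proof -
    have "L / 3 - 3 * (l / 6)\<^sup>2 = (l / 2)\<^sup>2" using l by (simp add: power_divide)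
    then show ?thesis using l(1) by (intro real_sqrt_unique) auto
  qed
  have end_k: "?k (l / 6) = L\<^sup>2"
    unfolding end_D unfolding l(2)[symmetric] by (simp add: power_divide power2_eq_square power3_eq_cube)
  have "\<exists>s\<ge>0. s \<le> l / 6 \<and> ?k s = b"
  proof (rule IVT')
    show "?k 0 \<le> b" "b \<le> ?k (l / 6)" unfolding end_k using assms by auto
    show "continuous_on {0..l / 6} ?k" by (intro continuous_intros)
  qed (use l in auto)
  then obtain s where s: "0 \<le> s" "s \<le> l / 6" "?k s = b" by auto
  then have "s \<noteq> l / 6" using end_k assms by auto
  then have s': "s < l / 6" using s by simp
  have "s\<^sup>2 < (l / 6)\<^sup>2" using s s' by (intro power_strict_mono) auto
  then have sq: "12 * s\<^sup>2 < L / 3" using l by (simp add: power_divide)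
  show ?thesis
  proof
    show "(?D s)\<^sup>2 = L / 3 - 3 * s\<^sup>2" using sq zero_le_power2[of s] by (intro real_sqrt_pow2) linarith
    show "3 * s < ?D s" using sq s by (intro real_less_rsqrt) (simp add: power2_eq_square)
  qed (use s in auto)
qed

text \<open>The three levels with a common value of the cubic have sum \<open>1 + a = 3 * c\<close>,
  hence the form \<open>c + s - D\<close>, \<open>c + s + D\<close>, \<open>c - 2 * s\<close>. The
  signed area between graph and chord over \<open>{u1..u2}\<close> is
  \<open>- 4 * (s * D ^ 3)\<close>. It is made equal to \<open>- (1 - 2 * a) / 12\<close>, so that
  flattening raises the mean of the cubic to \<open>d / 2\<close>.\<close>

lemma equal_area_levels:
  fixes a d :: real
  assumes a: "0 < a" "a \<le> 1/2" and d: "0 < d" "d < pinning_bound a"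
  obtains u1 u2 w where "0 < u1" "u1 \<le> a" "a \<le> u2" "u1 < w" "w < u2" "u2 < 1"
    and "\<forall>v. reaction_balance a d v = reaction_balance a d u1 + (v - u1) * (v - u2) * (v - w)"
    and "reaction_balance_primitive a d u2 - reaction_balance_primitive a d u1 =
      (u2 - u1) * reaction_balance a d u1 - (1 - 2 * a) / 12"
proof -
  define L where "L = 1 - a + a\<^sup>2 - 3 * d"
  define \<sigma> where "\<sigma> = (1 - 2 * a) / 6"
  have sL: "sqrt (1 - 2 * a) < L" using d a by (simp add: pinning_bound_eq L_def)
  then have L: "0 < L" using real_sqrt_ge_zero[of "1 - 2 * a"] a by linarith
  have "(sqrt (1 - 2 * a))\<^sup>2 < L\<^sup>2" using sL a by (intro power_strict_mono) auto
  then have "1 - 2 * a < L\<^sup>2" using a by simp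
  with jump_parameters_exist[of "1 - 2 * a" L] a L
  obtain s D where sD: "0 \<le> s" "3 * s < D" "D\<^sup>2 = L / 3 - 3 * s\<^sup>2" "48 * (s * D ^ 3) = 1 - 2 * a"
    by auto
  have a_eq: "a = 1/2 - 3 * \<sigma>" by (simp add: \<sigma>_def field_simps)
  have L_eq: "L / 3 = 1/4 + 3 * \<sigma>\<^sup>2 - d" unfolding L_def a_eq by (simp add: field_simps power2_eq_square)
  have d_eq: "d = 1/4 + 3 * \<sigma>\<^sup>2 - 3 * s\<^sup>2 - D\<^sup>2" using sD(3) L_eq by simp
  have \<sigma>: "0 \<le> \<sigma>" "\<sigma> < 1/6" using a by (auto simp: \<sigma>_def)
  have area: "s * D ^ 3 = \<sigma> / 8" using sD(4) by (simp add: \<sigma>_def)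
  have bounds: "D < 1/2" "\<sigma> \<le> s" "s + D < \<sigma> + 1/2"
    using jump_levels_move_inwards[OF area] sD d(1) \<sigma> unfolding d_eq by auto
  define c where "c = 1/2 - \<sigma>"
  have c: "1 + a = 3 * c"
    using a_eq by (simp add: c_def)
  have "(1/2 - \<sigma>)\<^sup>2 = 1/4 - \<sigma> + \<sigma>\<^sup>2" by (simp add: power2_eq_square algebra_simps)
  then have c': "a + d = 3 * c\<^sup>2 - 3 * s\<^sup>2 - D\<^sup>2"
    using a_eq d_eq by (simp add: c_def)
  define u1 u2 w where "u1 = c + s - D" and "u2 = c + s + D" and "w = c - 2 * s"
  have fact: "reaction_balance a d v = reaction_balance a d u1 + (v - u1) * (v - u2) * (v - w)" for v
    unfolding reaction_balance_eq c c' u1_def u2_def w_def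
    by (simp add: algebra_simps power2_eq_square power3_eq_cube)
  \<comment> \<open>A primitive in powers centred at the midpoint \<open>c + s\<close> of the two
    levels, so that the even powers cancel.\<close>
  let ?\<Phi> = "\<lambda>v. (v - (c + s)) ^ 4 / 4 + s * (v - (c + s)) ^ 3 - D\<^sup>2 * (v - (c + s))\<^sup>2 / 2
    - 3 * s * D\<^sup>2 * (v - (c + s)) + reaction_balance a d u1 * v"
  have "(?\<Phi> has_real_derivative reaction_balance a d v) (at v within S)" for v S
  proof -
    define x where "x = v - (c + s)"
    have "(?\<Phi> has_real_derivative (x ^ 3 + s * (3 * x\<^sup>2) - D\<^sup>2 * x - 3 * s * D\<^sup>2 + reaction_balance a d u1)) (at v within S)"
      unfolding x_def by (auto intro!: derivative_eq_intros)
    also have "x ^ 3 + s * (3 * x\<^sup>2) - D\<^sup>2 * x - 3 * s * D\<^sup>2 + reaction_balance a d u1 = reaction_balance a d v"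
    proof -
      have "v - u1 = x + D" "v - u2 = x - D" "v - w = x + 3 * s"
        by (simp_all add: u1_def u2_def w_def x_def)
      then show ?thesis
        unfolding fact[of v] by (simp only:) (simp add: algebra_simps power2_eq_square power3_eq_cube)
    qed
    finally show ?thesis .
  qed
  then have "(reaction_balance a d has_integral ?\<Phi> u2 - ?\<Phi> u1) {u1..u2}"
    using sD by (intro fundamental_theorem_of_calculus)
      (auto simp: u1_def u2_def simp flip: has_real_derivative_iff_has_vector_derivative)
  moreover have "(reaction_balance a d has_integral
      reaction_balance_primitive a d u2 - reaction_balance_primitive a d u1) {u1..u2}"
    using sD by (intro reaction_balance_has_integral) (simp add: u1_def u2_def)
  ultimately have "reaction_balance_primitive a d u2 - reaction_balance_primitive a d u1 = ?\<Phi> u2 - ?\<Phi> u1"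
    by (rule has_integral_unique[rotated])
  also have "\<dots> = (u2 - u1) * reaction_balance a d u1 - 4 * (s * D ^ 3)"
  proof -
    have "u2 - (c + s) = D" "u1 - (c + s) = - D" by (simp_all add: u1_def u2_def)
    then show ?thesis by (simp only:) (simp add: field_simps power2_eq_square power3_eq_cube)
  qed
  also have "\<dots> = (u2 - u1) * reaction_balance a d u1 - (1 - 2 * a) / 12"
    using sD(4) by simp
  finally have "reaction_balance_primitive a d u2 - reaction_balance_primitive a d u1 =
      (u2 - u1) * reaction_balance a d u1 - (1 - 2 * a) / 12" .
  moreover have "0 < u1" "u1 \<le> a" "a \<le> u2" "u1 < w" "w < u2" "u2 < 1"
    using sD(1,2) bounds \<sigma> a_eq unfolding u1_def u2_def w_def c_def by linarith+
  ultimately show ?thesis using that[of u1 u2 w] fact by blast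
qed

text \<open>Up to \<open>z\<close> the integral is a multiple of a positive value. Beyond
  \<open>z\<close> it is minus the integral over the rest, a multiple of a negative value.\<close>

lemma integral_pos_of_sign_change:
  fixes \<phi> :: "real \<Rightarrow> real"
  assumes c: "continuous_on {0..1} \<phi>" and total: "integral {0..1} \<phi> = 0"
    and pos: "\<And>s. 0 < s \<Longrightarrow> s < z \<Longrightarrow> 0 < \<phi> s" and neg: "\<And>s. z < s \<Longrightarrow> s < 1 \<Longrightarrow> \<phi> s < 0"
    and t: "0 < t" "t < 1"
  shows "0 < integral {0..t} \<phi>"
proof (cases "t \<le> z")
  case True
  obtain \<xi> where "0 < \<xi>" "\<xi> < t" "(integral {0..t} \<phi> - integral {0..0} \<phi>) / (t - 0) = \<phi> \<xi>"
    using integral_mean_value[OF c, of 0 t] t by auto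
  then have "0 < integral {0..t} \<phi> / t" using pos[of \<xi>] True by simp
  then show ?thesis using t by (simp add: zero_less_divide_iff)
next
  case False
  obtain \<xi> where "t < \<xi>" "\<xi> < 1" "(integral {0..1} \<phi> - integral {0..t} \<phi>) / (1 - t) = \<phi> \<xi>"
    using integral_mean_value[OF c, of t 1] t by auto
  then have "(integral {0..1} \<phi> - integral {0..t} \<phi>) / (1 - t) < 0" using neg[of \<xi>] False by simp
  then show ?thesis using total t by (simp add: divide_less_0_iff zero_less_divide_iff)
qed

lemma mult3_strict_mono:
  fixes x y z :: real
  assumes "0 \<le> x" "x < x'" "0 \<le> y" "y < y'" "0 \<le> z" "z < z'"
  shows "x * y * z < x' * y' * z'"
  using assms by (intro mult_strict_mono) auto

context kernel
begin

text \<open>The profile is \<open>1/2 - H / d\<close> with \<open>H\<close> the flattened cubic. Its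
  deficit at \<open>t\<close> is the integral of \<open>\<phi> / d\<close> up to \<open>t\<close>,
  and it is positive because \<phi> has mean zero and changes sign once, from plus to minus.\<close>

lemma stationary_interface_exists_left:
  assumes a: "0 < a" "a \<le> 1/2" and d: "0 < d" "d < pinning_bound a"
  shows "\<exists>u. stationary_interface K (cubic a) d u"
proof -
  let ?G = "reaction_balance a d"
  obtain u1 u2 w where u: "0 < u1" "u1 \<le> a" "a \<le> u2" "u1 < w" "w < u2" "u2 < 1"
    and fact_all: "\<forall>v. ?G v = ?G u1 + (v - u1) * (v - u2) * (v - w)"
    and area: "reaction_balance_primitive a d u2 - reaction_balance_primitive a d u1 =
      (u2 - u1) * ?G u1 - (1 - 2 * a) / 12"
    by (rule equal_area_levels[OF a d]) (rule that; assumption)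
  note fact = fact_all[rule_format]
  have G2: "?G u2 = ?G u1" using fact[of u2] by simp
  \<comment> \<open>Clamping the arguments makes continuity immediate; by
    \<open>?G u2 = ?G u1\<close> the sum is \<open>?G\<close> outside \<open>{u1..u2}\<close> and
    constant on it.\<close>
  define H where "H t = ?G (min t u1) + ?G (max t u2) - ?G u1" for t
  have H: "t \<le> u1 \<Longrightarrow> H t = ?G t" "u2 \<le> t \<Longrightarrow> H t = ?G t" "u1 \<le> t \<Longrightarrow> t \<le> u2 \<Longrightarrow> H t = ?G u1" for t
    using u G2 by (auto simp: H_def)
  have H_cont: "continuous_on S H" for S
    unfolding H_def by (intro continuous_intros)
  have H_integral: "(H has_integral d / 2) {0..1}"
  proof -
    have "(H has_integral reaction_balance_primitive a d u1 - reaction_balance_primitive a d 0) {0..u1}"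
      by (rule has_integral_eq[OF _ reaction_balance_has_integral]) (use u H in auto)
    moreover have "(H has_integral (u2 - u1) * ?G u1) {u1..u2}"
      by (rule has_integral_eq[of _ "\<lambda>_. ?G u1"]) (use u H has_integral_const_real[of "?G u1" u1 u2] in auto)
    ultimately have "(H has_integral reaction_balance_primitive a d u1 - reaction_balance_primitive a d 0 + (u2 - u1) * ?G u1) {0..u2}"
      by (rule has_integral_combine[rotated 2]) (use u in auto)
    moreover have "(H has_integral reaction_balance_primitive a d 1 - reaction_balance_primitive a d u2) {u2..1}"
      by (rule has_integral_eq[OF _ reaction_balance_has_integral]) (use u H in auto)
    ultimately have "(H has_integral reaction_balance_primitive a d u1 - reaction_balance_primitive a d 0 + (u2 - u1) * ?G u1
      + (reaction_balance_primitive a d 1 - reaction_balance_primitive a d u2)) {0..1}"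
      by (rule has_integral_combine[rotated 2]) (use u in auto)
    moreover have "reaction_balance_primitive a d u1 - reaction_balance_primitive a d 0 + (u2 - u1) * ?G u1
      + (reaction_balance_primitive a d 1 - reaction_balance_primitive a d u2) = d / 2"
    proof -
      have "reaction_balance_primitive a d 1 - reaction_balance_primitive a d 0 = d / 2 - (1 - 2 * a) / 12"
        by (simp add: reaction_balance_primitive_def field_simps)
      then show ?thesis using area by linarith
    qed
    ultimately show ?thesis by simp
  qed
  define \<phi> where "\<phi> t = H t - d * t" for t
  have \<phi>_cont: "continuous_on S \<phi>" for S
    unfolding \<phi>_def by (intro continuous_intros H_cont)
  have id_integral: "((\<lambda>s. s) has_integral t\<^sup>2 / 2) {0..t}" if "0 \<le> t" for t :: real
    using ident_has_integral[of 0 t] that by simp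
  have \<phi>_total: "integral {0..1} \<phi> = 0"
    using has_integral_diff[OF H_integral has_integral_mult_right[OF id_integral[of 1], of d]]
    unfolding \<phi>_def[abs_def] by (simp add: integral_unique)
  have G_diag: "?G v - d * v = v * (1 - v) * (a - v)" for v
    by (simp add: reaction_balance_def cubic_def algebra_simps)
  have G1_ge: "d * u1 \<le> ?G u1"
  proof -
    have "0 \<le> u1 * (1 - u1) * (a - u1)" using u a by auto
    then show ?thesis using G_diag[of u1] by simp
  qed
  have G2_le: "?G u1 \<le> d * u2"
  proof -
    have "u2 * (1 - u2) * (a - u2) \<le> 0" using u by (intro mult_nonneg_nonpos) auto
    then show ?thesis using G_diag[of u2] G2 by simp
  qed
  \<comment> \<open>Inside the unit interval the line \<open>d * t\<close> meets \<open>H\<close>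
    only at the level \<open>?G u1 / d\<close>, which \<open>G1_ge\<close> and \<open>G2_le\<close>
    place between \<open>u1\<close> and \<open>u2\<close>.\<close>
  have \<phi>_pos: "0 < \<phi> s" if s: "0 < s" "s < ?G u1 / d" for s
  proof (cases "s < u1")
    case True
    then have "0 < s * (1 - s) * (a - s)" using s u by auto
    then show ?thesis using True G_diag[of s] by (simp add: \<phi>_def H)
  next
    case False
    moreover have "d * s < ?G u1" using s d by (simp add: field_simps)
    moreover from this have "d * s < d * u2" using G2_le by linarith
    ultimately show ?thesis using d by (simp add: \<phi>_def H)
  qed
  have \<phi>_neg: "\<phi> s < 0" if s: "?G u1 / d < s" "s < 1" for s
  proof (cases "u2 < s")
    case True
    then have "s * (1 - s) * (a - s) < 0" using s u by (intro mult_pos_neg) auto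
    then show ?thesis using True G_diag[of s] by (simp add: \<phi>_def H)
  next
    case False
    moreover have "?G u1 < d * s" using s d by (simp add: field_simps)
    moreover from this have "d * u1 < d * s" using G1_ge by linarith
    ultimately show ?thesis using d by (simp add: \<phi>_def H)
  qed
  define p where "p t = 1/2 - H t / d" for t
  have p_integral: "integral {0..t} p = t * (1 - t) / 2 - integral {0..t} \<phi> / d" if "0 \<le> t" for t
  proof -
    have half: "((\<lambda>s. 1/2) has_integral t / 2) {0..t}"
      using has_integral_const_real[of "1/2::real" 0 t] that by simp
    have "(\<phi> has_integral integral {0..t} \<phi>) {0..t}"
      by (intro integrable_integral integrable_continuous_real \<phi>_cont)
    then have "((\<lambda>s. 1/2 - s - \<phi> s / d) has_integral t / 2 - t\<^sup>2 / 2 - integral {0..t} \<phi> / d) {0..t}"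
      by (rule has_integral_diff[OF has_integral_diff[OF half id_integral[OF that]] has_integral_divide])
    moreover have "(\<lambda>s. 1/2 - s - \<phi> s / d) = p"
      using d by (auto simp: p_def \<phi>_def field_simps)
    ultimately show ?thesis by (simp add: integral_unique power2_eq_square field_simps)
  qed
  interpret flat_profile K p u1 u2
  proof
    show "continuous_on {0..1} p"
      unfolding p_def using d by (intro continuous_intros H_cont) auto
    show "0 < u1" "u1 < u2" "u2 < 1" using u by auto
    show "p t < p s" if "0 \<le> s" "s < t" "t \<le> u1" for s t
    proof -
      have "(u1 - t) * (u2 - t) * (w - t) < (u1 - s) * (u2 - s) * (w - s)"
        using that u by (intro mult3_strict_mono) auto
      then have "?G s < ?G t" unfolding fact[of s] fact[of t] by (simp add: algebra_simps)
      then show ?thesis using that d by (simp add: p_def H divide_strict_right_mono)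
    qed
    show "p t < p s" if "u2 \<le> s" "s < t" "t \<le> 1" for s t
    proof -
      have "(s - u1) * (s - u2) * (s - w) < (t - u1) * (t - u2) * (t - w)"
        using that u by (intro mult3_strict_mono) auto
      then have "?G s < ?G t" unfolding fact[of s] fact[of t] by simp
      then show ?thesis using that d by (simp add: p_def H divide_strict_right_mono)
    qed
    show "p t = p u1" if "u1 \<le> t" "t \<le> u2" for t using that by (simp add: p_def H)
    show "integral {0..1} p = 0" using p_integral[of 1] \<phi>_total by simp
    show "integral {0..t} p < t * (1 - t) / 2" if "0 < t" "t < 1" for t
      using p_integral[of t] integral_pos_of_sign_change[OF \<phi>_cont \<phi>_total \<phi>_pos \<phi>_neg that] that d by simp
  qed
  have "p 0 = 1/2" using u H(1)[of 0] by (simp add: p_def reaction_balance_def cubic_def)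
  moreover have "p 1 = - 1/2" using u d H(2)[of 1] by (simp add: p_def reaction_balance_def cubic_def)
  ultimately obtain v where v: "antimono v" "\<And>x. v x \<in> {0..1}" "(v \<longlongrightarrow> 1) at_bot" "(v \<longlongrightarrow> 0) at_top"
    and jump: "\<And>x. v x \<le> u1 \<or> u2 \<le> v x" and conv: "\<And>x. convolution K v x = 1/2 - p (v x)"
    using profile_interface by blast
  have "0 = d * (- v x + convolution K v x) + cubic a (v x)" for x
  proof -
    have "d * convolution K v x = H (v x)" using d by (simp add: conv p_def)
    also have "\<dots> = ?G (v x)" using jump[of x] H by auto
    finally show ?thesis by (simp add: reaction_balance_def algebra_simps)
  qed
  then show ?thesis using v by (auto simp: stationary_interface_def)
qed

lemma stationary_interface_exists:
  assumes a: "0 < a" "a < 1" and d: "0 < d" "d < pinning_bound a"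
  shows "\<exists>u. stationary_interface K (cubic a) d u"
proof (cases "a \<le> 1/2")
  case False
  then obtain u where "stationary_interface K (cubic (1 - a)) d u"
    using stationary_interface_exists_left[of "1 - a" d] a d by (auto simp: pinning_bound_reflect)
  from stationary_interface_reflect[OF this] show ?thesis by auto
qed (use stationary_interface_exists_left assms in auto)

section \<open>The pinning region\<close>

text \<open>With \<open>s = sqrt \<bar>1 - 2 * a\<bar>\<close> the difference of the two sides is
  \<open>(s - s ^ 4 / 4) / 3\<close>, and \<open>s ^ 4 \<le> s\<close>.\<close>

lemma (in -) pinning_bound_le_half: "pinning_bound a \<le> pinning_bound (1/2)" if "0 < a" "a < 1"
proof -
  define s where "s = sqrt \<bar>1 - 2 * a\<bar>"
  have s: "0 \<le> s" "s < 1" using that by (auto simp: s_def)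
  have "s\<^sup>2 = \<bar>1 - 2 * a\<bar>" by (simp add: s_def)
  then have "(s\<^sup>2)\<^sup>2 = (1 - 2 * a)\<^sup>2" by (simp only: power2_abs)
  moreover have "s ^ 4 \<le> s" using power_decreasing[of 1 4 s] s by simp
  ultimately have "(1 - 2 * a)\<^sup>2 \<le> s" by simp
  then show ?thesis
    using s unfolding pinning_bound_eq s_def[symmetric] by (simp add: power2_eq_square algebra_simps)
qed

text \<open>The set on the right is open, so existence puts it into the interior. Conversely
  nonexistence yields only a weak inequality off \<open>a = 1/2\<close>; a ball of parameters leaves
  room to raise \<open>d\<close>, which makes it strict.\<close>

lemma pinning_region_eq:
  "pinning_region K = {(a, d). a \<in> {0<..<1} \<and> 0 < d \<and> d < pinning_bound a}" (is "_ = ?R")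
proof
  let ?S = "{(a, d) \<in> {0<..<1} \<times> {0<..}. \<exists>u. stationary_interface K (cubic a) d u}"
  have "open ?R"
  proof -
    have "?R = {x. 0 < fst x} \<inter> {x. fst x < 1} \<inter> {x. 0 < snd x} \<inter> {x. snd x < pinning_bound (fst x)}"
      by auto
    then show ?thesis
      unfolding pinning_bound_eq by (auto intro!: open_Int open_Collect_less continuous_intros)
  qed
  moreover have "?R \<subseteq> ?S" using stationary_interface_exists by auto
  ultimately show "?R \<subseteq> pinning_region K"
    unfolding pinning_region_def by (rule interior_maximal[rotated])
  show "pinning_region K \<subseteq> ?R"
  proof clarify
    fix a d assume "(a, d) \<in> pinning_region K"
    then obtain e where e: "0 < e" "ball (a, d) e \<subseteq> ?S"
      unfolding pinning_region_def mem_interior by blast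
    have S: "(a', d') \<in> ?S" if "\<bar>a' - a\<bar> < e / 2" "\<bar>d' - d\<bar> < e / 2" for a' d'
    proof -
      have "dist (a, d) (a', d') = sqrt ((a - a')\<^sup>2 + (d - d')\<^sup>2)"
        by (simp add: dist_Pair_Pair dist_real_def)
      also have "\<dots> \<le> \<bar>a - a'\<bar> + \<bar>d - d'\<bar>" by (rule sqrt_sum_squares_le_sum_abs)
      also have "\<dots> < e" using that by linarith
      finally show ?thesis using e(2) by auto
    qed
    have ad: "a \<in> {0<..<1}" "0 < d" using S[of a d] e by auto
    have "d < pinning_bound a"
    proof (cases "a = 1/2")
      case False
      then have "d + e / 4 \<le> pinning_bound a"
        using S[of a "d + e / 4"] e stationary_interface_bound by auto
      then show ?thesis using e by simp
    next
      case True
      \<comment> \<open>As \<open>stationary_interface_bound\<close> excludes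
        \<open>a = 1/2\<close>, \<open>a\<close> is moved together with \<open>d\<close>, and the
        bound there is compared with its maximum at \<open>1/2\<close>.\<close>
      have st: "(a + e / 4, d + e / 4) \<in> ?S" by (rule S) (use e in auto)
      then obtain u where "stationary_interface K (cubic (a + e / 4)) (d + e / 4) u" by auto
      then have "d + e / 4 \<le> pinning_bound (a + e / 4)"
        by (rule stationary_interface_bound) (use True e in auto)
      also have "\<dots> \<le> pinning_bound a"
        unfolding True using pinning_bound_le_half[of "1/2 + e / 4"] st[unfolded True] by auto
      finally show ?thesis using e by simp
    qed
    then show "a \<in> {0<..<1} \<and> 0 < d \<and> d < pinning_bound a" using ad by simp
  qed
qed

end

section \<open>Expansion of the bounding curve at its tip\<close>

definition bound_profile :: "real \<Rightarrow> real" where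
  "bound_profile s = 1/4 - s / 3 + s ^ 4 / 12"

text \<open>Since \<open>1 - a + a\<^sup>2 = 3/4 + (1 - 2 * a)\<^sup>2 / 4\<close>, the bound is a
  polynomial in the square root.\<close>

lemma pinning_bound_profile: "pinning_bound a = bound_profile (sqrt \<bar>1 - 2 * a\<bar>)"
proof -
  have "x ^ 4 = (x\<^sup>2)\<^sup>2" for x :: real by simp
  then have "sqrt \<bar>1 - 2 * a\<bar> ^ 4 = ((sqrt \<bar>1 - 2 * a\<bar>)\<^sup>2)\<^sup>2" .
  also have "\<dots> = (1 - 2 * a)\<^sup>2" by (simp only: real_sqrt_pow2 abs_ge_zero power2_abs)
  finally show ?thesis
    unfolding pinning_bound_eq bound_profile_def by (simp add: power2_eq_square field_simps)
qed

lemma bound_profile_decreasing: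
  assumes "0 \<le> s" "s < t" "t \<le> 1"
  shows "bound_profile t < bound_profile s"
proof -
  have "t ^ 4 - s ^ 4 = (t - s) * ((t + s) * (t\<^sup>2 + s\<^sup>2))"
    by (simp add: algebra_simps power2_eq_square power4_eq_xxxx)
  also have "\<dots> < (t - s) * (2 * 2)"
  proof (intro mult_strict_left_mono mult_strict_mono')
    have "t\<^sup>2 \<le> 1" "s\<^sup>2 < 1" using assms by (auto simp: power_le_one abs_square_less_1)
    then show "t\<^sup>2 + s\<^sup>2 < 2" by simp
  qed (use assms in auto)
  finally show ?thesis by (simp add: bound_profile_def field_simps)
qed

lemma bound_profile_surj:
  assumes "0 < d" "d < 1/4"
  obtains s where "0 < s" "s < 1" "bound_profile s = d"
proof -
  have "\<exists>s\<ge>0. s \<le> 1 \<and> bound_profile s = d"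
    by (rule IVT2') (use assms in \<open>auto simp: bound_profile_def intro!: continuous_intros\<close>)
  then obtain s where "0 \<le> s" "s \<le> 1" "bound_profile s = d" by auto
  moreover from this have "s \<noteq> 0" "s \<noteq> 1" using assms by (auto simp: bound_profile_def)
  ultimately show ?thesis using that[of s] by auto
qed

text \<open>With \<open>x = 1/4 - d\<close> the equation reads \<open>s = 3 * x + s ^ 4 / 4\<close>,
  so the difference to be bounded is \<open>s ^ 4 * (s + 3 * x) / 8\<close>. From
  \<open>s \<le> 4 * x\<close> and \<open>x \<le> 1/4\<close> comes the constant
  \<open>56 = 4 ^ 4 * (7 / 4) / 8\<close>.\<close>

lemma bound_profile_inverse_asymptotics:
  assumes s: "0 < s" "s < 1" and d: "bound_profile s = d"
  shows "\<bar>s\<^sup>2 / 2 - 9 / 2 * (d - 1/4)\<^sup>2\<bar> \<le> 56 * (d - 1/4) ^ 4"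
proof -
  define x where "x = 1/4 - d"
  have x_eq: "s - 3 * x = s ^ 4 / 4" using d by (simp add: x_def bound_profile_def)
  have s3: "s ^ 4 \<le> s" using power_decreasing[of 1 4 s] s by simp
  have x0: "0 < x" using x_eq s3 s by linarith
  have sx: "s \<le> 4 * x" using x_eq s3 by linarith
  have x1: "x \<le> 1/4"
    using x_eq s bound_profile_decreasing[of s 1] d by (simp add: x_def bound_profile_def)
  have "s\<^sup>2 / 2 - 9 / 2 * x\<^sup>2 = (s - 3 * x) * (s + 3 * x) / 2"
    by (simp add: algebra_simps power2_eq_square)
  also have "\<dots> = s ^ 4 * (s + 3 * x) / 8" by (simp add: x_eq)
  finally have eq: "s\<^sup>2 / 2 - 9 / 2 * x\<^sup>2 = s ^ 4 * (s + 3 * x) / 8" .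
  have "s ^ 4 * (s + 3 * x) \<le> (4 * x) ^ 4 * (7 / 4)"
    using s sx x0 x1 by (intro mult_mono power_mono) auto
  then have "s\<^sup>2 / 2 - 9 / 2 * x\<^sup>2 \<le> 56 * x ^ 4" unfolding eq by (simp add: power_mult_distrib)
  moreover have "0 \<le> s\<^sup>2 / 2 - 9 / 2 * x\<^sup>2" unfolding eq using s x0 by simp
  moreover have "x\<^sup>2 = (d - 1/4)\<^sup>2" "x ^ 4 = (d - 1/4) ^ 4"
    using power_minus_even[of 4 "d - 1/4"] by (auto simp: x_def power2_commute)
  ultimately show ?thesis by simp
qed

theorem lemma2p2:
  fixes K :: "real \<Rightarrow> real"
  assumes "admissible_kernel K"
  shows "pinning_region K = {(a, d). a \<in> {0<..<1} \<and> 0 < d \<and> d < pinning_bound a} \<and>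
    {d. \<exists>a. (a, d) \<in> pinning_region K} = {0<..<1/4} \<and>
    (\<exists>a_minus a_plus :: real \<Rightarrow> real.
      (\<forall>d\<in>{0<..<1/4}. a_minus d < a_plus d \<and>
         {a. (a, d) \<in> pinning_region K} = {a_minus d<..<a_plus d}) \<and>
      (\<lambda>d. a_minus d - (1/2 - 9/2 * (d - 1/4)\<^sup>2)) \<in> O[at_left (1/4)](\<lambda>d. (d - 1/4) ^ 4) \<and>
      (\<lambda>d. a_plus d - (1/2 + 9/2 * (d - 1/4)\<^sup>2)) \<in> O[at_left (1/4)](\<lambda>d. (d - 1/4) ^ 4))"
proof -
  interpret kernel K
    by unfold_locales (use assms in \<open>auto simp: admissible_kernel_def\<close>)
  obtain s where s: "\<And>d. 0 < d \<Longrightarrow> d < 1/4 \<Longrightarrow> 0 < s d \<and> s d < 1 \<and> bound_profile (s d) = d"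
  proof -
    have "\<forall>d. \<exists>t. 0 < d \<longrightarrow> d < 1/4 \<longrightarrow> 0 < t \<and> t < 1 \<and> bound_profile t = d"
      using bound_profile_surj by blast
    then have "\<exists>s. \<forall>d. 0 < d \<longrightarrow> d < 1/4 \<longrightarrow> 0 < s d \<and> s d < 1 \<and> bound_profile (s d) = d"
      by (rule choice)
    then show ?thesis using that by blast
  qed
  \<comment> \<open>For \<open>a\<close> in the unit interval \<open>d < pinning_bound a\<close>
    means \<open>sqrt \<bar>1 - 2 * a\<bar> < s d\<close>, an interval around \<open>1/2\<close> of
    half-width \<open>(s d)\<^sup>2 / 2\<close>.\<close>
  let ?am = "\<lambda>d. 1/2 - (s d)\<^sup>2 / 2" and ?ap = "\<lambda>d. 1/2 + (s d)\<^sup>2 / 2"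
  have slice: "(a, d) \<in> pinning_region K \<longleftrightarrow> ?am d < a \<and> a < ?ap d" if d: "0 < d" "d < 1/4" for a d
  proof -
    have sd: "0 < s d" "s d < 1" "bound_profile (s d) = d" using s[OF d] by auto
    have s2: "(s d)\<^sup>2 < 1" using sd by (simp add: abs_square_less_1)
    have bound_iff: "d < pinning_bound a \<longleftrightarrow> \<bar>1 - 2 * a\<bar> < (s d)\<^sup>2" if "0 < a" "a < 1"
    proof -
      define r where "r = sqrt \<bar>1 - 2 * a\<bar>"
      have r: "0 \<le> r" "r < 1" using that by (auto simp: r_def)
      have "d < pinning_bound a \<longleftrightarrow> bound_profile (s d) < bound_profile r"
        using sd(3) by (simp add: pinning_bound_profile r_def)
      also have "\<dots> \<longleftrightarrow> r < s d"
        using bound_profile_decreasing[of r "s d"] bound_profile_decreasing[of "s d" r] r sd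
        by (cases r "s d" rule: linorder_cases) auto
      also have "\<dots> \<longleftrightarrow> \<bar>1 - 2 * a\<bar> < (s d)\<^sup>2"
        using sd(1) real_sqrt_less_iff[of "\<bar>1 - 2 * a\<bar>" "(s d)\<^sup>2"] by (simp add: r_def)
      finally show ?thesis .
    qed
    have "\<bar>1 - 2 * a\<bar> < (s d)\<^sup>2 \<longleftrightarrow> ?am d < a \<and> a < ?ap d" by (auto simp: abs_less_iff)
    then show ?thesis
      unfolding pinning_region_eq using d bound_iff s2 by auto
  qed
  have "d < 1/4" if "(a, d) \<in> pinning_region K" for a d
    using that pinning_bound_le_half[of a]
    by (auto simp: pinning_region_eq pinning_bound_eq power2_eq_square)
  moreover have "0 < d" if "(a, d) \<in> pinning_region K" for a d
    using that by (simp add: pinning_region_eq)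
  moreover have "(1/2, d) \<in> pinning_region K" if "0 < d" "d < 1/4" for d
    using slice[OF that] s[OF that] by auto
  ultimately have proj: "{d. \<exists>a. (a, d) \<in> pinning_region K} = {0<..<1/4}" by fastforce
  have ev: "\<forall>\<^sub>F d in at_left (1/4::real). \<bar>(s d)\<^sup>2 / 2 - 9/2 * (d - 1/4)\<^sup>2\<bar> \<le> 56 * (d - 1/4) ^ 4"
    unfolding eventually_at_left_field
    using s bound_profile_inverse_asymptotics by (intro exI[of _ 0]) auto
  have minus: "(\<lambda>d. ?am d - (1/2 - 9/2 * (d - 1/4)\<^sup>2)) \<in> O[at_left (1/4)](\<lambda>d. (d - 1/4) ^ 4)"
    using ev by (intro bigoI[where c = 56]) (auto elim!: eventually_mono simp: abs_minus_commute)
  have plus: "(\<lambda>d. ?ap d - (1/2 + 9/2 * (d - 1/4)\<^sup>2)) \<in> O[at_left (1/4)](\<lambda>d. (d - 1/4) ^ 4)"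
    using ev by (intro bigoI[where c = 56]) (auto elim!: eventually_mono)
  have "?am d < ?ap d \<and> {a. (a, d) \<in> pinning_region K} = {?am d<..<?ap d}" if "d \<in> {0<..<1/4}" for d
  proof
    have d: "0 < d" "d < 1/4" using that by auto
    show "?am d < ?ap d" using s[OF d] by simp
    show "{a. (a, d) \<in> pinning_region K} = {?am d<..<?ap d}"
      by (rule set_eqI) (simp only: mem_Collect_eq greaterThanLessThan_iff slice[OF d])
  qed
  then have interval: "\<forall>d\<in>{0<..<1/4}. ?am d < ?ap d \<and> {a. (a, d) \<in> pinning_region K} = {?am d<..<?ap d}"
    by blast
  show ?thesis
    by (rule conjI[OF pinning_region_eq conjI[OF proj]], rule exI[of _ ?am], rule exI[of _ ?ap],
        rule conjI[OF interval conjI[OF minus plus]])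
qed

end
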